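(* Let $\{X(t):t\ge 0\}$ be a continuous-time, irreducible, positive recurrent birth-and-death process on $\mathcal{S}=\{0,1,2,\ldots\}$ with birth rates $\lambda_n>0$ ($n\ge0$), death rates $\mu_n>0$ ($n\ge1$) and stationary distribution $(\pi_n)_{n\ge0}$. Let $$\Theta=\sum_{k\ge 0}(\lambda_k\pi_k)^{-1}\sum_{j\ge k+1}\pi_j,\qquad K'=\sum_{j\ge0}\pi_j\,\mathrm{E}_0[\theta_j].$$ If $\Theta<\infty$, then $$K'=\lim_{t\to\infty}\Big(\sum_{j\in\mathcal{S}}\mathrm{E}_j[M_j(t)]-t\Big),$$ where $M_j(t)=\int_0^t\mathbb{1}\{X(u)=j\}\,\mathrm{d}u$ is the total time spent in $j$ until time $t$.
   Context: $\lambda_n$ and $\mu_n$ are the transition rates from $n$ to $n+1$ and from $n$ to $n-1$, respectively. Positive recurrence entails $B=\sum_{n\ge0}\beta_n<\infty$, where $\beta_0=1$ and $\beta_n=\frac{\lambda_0\cdots\lambda_{n-1}}{\mu_1\cdots\mu_n}$ for $n\ge1$, and $\pi_n=B^{-1}\beta_n$. $\theta_j=\inf\{t\ge0:X(t)=j\}$, and $\mathrm{E}_i[\cdot]$ is conditional expectation given $X(0)=i$. *)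

theory Defs
  imports "HOL-Probability.Probability"
begin

text \<open>A time-homogeneous Markov process on the natural numbers is given by a family of laws
  \<open>P i\<close> (started in \<open>i\<close>) on one measurable space and one process \<open>X\<close>; only times \<open>t \<ge> 0\<close> matter.
  Expectation given \<open>X(0) = i\<close> is integration with respect to \<open>P i\<close>. All the random quantities
  below are nonnegative, possibly infinite, so they take values in \<^typ>\<open>ennreal\<close>.\<close>

definition trans_prob :: "(nat \<Rightarrow> 'w measure) \<Rightarrow> (real \<Rightarrow> 'w \<Rightarrow> nat) \<Rightarrow> nat \<Rightarrow> nat \<Rightarrow> real \<Rightarrow> real"
  where "trans_prob P X i j t = measure (P i) {\<omega> \<in> space (P i). X t \<omega> = j}"

text \<open>The paths are right-continuous with left limits in the discrete topology of the state space.
  Left limits lie in the state space, so only finitely many jumps occur in bounded time: the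
  process does not explode. (Right-continuity alone would admit processes that are restarted in
  some state after each explosion.)\<close>

locale markov_jump_process =
  fixes M :: "'w measure" and P :: "nat \<Rightarrow> 'w measure" and X :: "real \<Rightarrow> 'w \<Rightarrow> nat"
  assumes prob_space_P: "\<And>i. prob_space (P i)"
    and sets_P: "\<And>i. sets (P i) = sets M"
    and measurable_X: "\<And>t. 0 \<le> t \<Longrightarrow> X t \<in> M \<rightarrow>\<^sub>M count_space UNIV"
    and start: "\<And>i. AE \<omega> in P i. X 0 \<omega> = i"
    and right_continuous_paths:
      "\<And>\<omega> t. \<omega> \<in> space M \<Longrightarrow> 0 \<le> t \<Longrightarrow> \<forall>\<^sub>F s in at_right t. X s \<omega> = X t \<omega>"
    and left_limits_paths:
      "\<And>\<omega> t. \<omega> \<in> space M \<Longrightarrow> 0 < t \<Longrightarrow> \<exists>k. \<forall>\<^sub>F s in at_left t. X s \<omega> = k"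
    and markov_property:
      "\<And>i n (\<tau> :: nat \<Rightarrow> real) (x :: nat \<Rightarrow> nat) s y.
         0 \<le> \<tau> 0 \<Longrightarrow> (\<And>k. k < n \<Longrightarrow> \<tau> k \<le> \<tau> (Suc k)) \<Longrightarrow> 0 \<le> s \<Longrightarrow>
         measure (P i) {\<omega> \<in> space (P i). (\<forall>k\<le>n. X (\<tau> k) \<omega> = x k) \<and> X (\<tau> n + s) \<omega> = y}
           = measure (P i) {\<omega> \<in> space (P i). \<forall>k\<le>n. X (\<tau> k) \<omega> = x k} * trans_prob P X (x n) y s"

text \<open>The three limits determine all transition rates: those between states that are not
  neighbours vanish, because the transition probabilities out of a state sum to one.
  The value \<open>mu 0\<close> is not used.\<close>

locale birth_death_process = markov_jump_process M P X
  for M :: "'w measure" and P :: "nat \<Rightarrow> 'w measure" and X :: "real \<Rightarrow> 'w \<Rightarrow> nat" +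
  fixes lam mu :: "nat \<Rightarrow> real"
  assumes birth_rate_pos: "\<And>n. 0 < lam n"
    and death_rate_pos: "\<And>n. 1 \<le> n \<Longrightarrow> 0 < mu n"
    and birth_rate: "\<And>n. ((\<lambda>h. trans_prob P X n (n + 1) h / h) \<longlongrightarrow> lam n) (at_right 0)"
    and death_rate: "\<And>n. 1 \<le> n \<Longrightarrow>
      ((\<lambda>h. trans_prob P X n (n - 1) h / h) \<longlongrightarrow> mu n) (at_right 0)"
    and exit_rate: "\<And>n.
      ((\<lambda>h. (1 - trans_prob P X n n h) / h) \<longlongrightarrow> lam n + (if n = 0 then 0 else mu n)) (at_right 0)"

definition irreducible_process :: "(nat \<Rightarrow> 'w measure) \<Rightarrow> (real \<Rightarrow> 'w \<Rightarrow> nat) \<Rightarrow> bool"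
  where "irreducible_process P X \<longleftrightarrow> (\<forall>i j. \<exists>t\<ge>0. 0 < trans_prob P X i j t)"

definition hitting_time :: "(real \<Rightarrow> 'w \<Rightarrow> nat) \<Rightarrow> nat \<Rightarrow> 'w \<Rightarrow> ennreal"
  where "hitting_time X j \<omega> = Inf {ennreal t | t. 0 \<le> t \<and> X t \<omega> = j}"

text \<open>Time of the first visit to \<open>j\<close> after having been outside \<open>j\<close>; for a path started in \<open>j\<close> this
  is the return time to \<open>j\<close>.\<close>

definition return_time :: "(real \<Rightarrow> 'w \<Rightarrow> nat) \<Rightarrow> nat \<Rightarrow> 'w \<Rightarrow> ennreal"
  where "return_time X j \<omega> =
    Inf {ennreal t | t. 0 \<le> t \<and> X t \<omega> = j \<and> (\<exists>s. 0 \<le> s \<and> s < t \<and> X s \<omega> \<noteq> j)}"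

definition positive_recurrent :: "(nat \<Rightarrow> 'w measure) \<Rightarrow> (real \<Rightarrow> 'w \<Rightarrow> nat) \<Rightarrow> bool"
  where "positive_recurrent P X \<longleftrightarrow> (\<forall>j. (\<integral>\<^sup>+\<omega>. return_time X j \<omega> \<partial>P j) < \<infinity>)"

definition stationary_distribution ::
  "(nat \<Rightarrow> 'w measure) \<Rightarrow> (real \<Rightarrow> 'w \<Rightarrow> nat) \<Rightarrow> nat pmf \<Rightarrow> bool"
  where "stationary_distribution P X \<pi> \<longleftrightarrow>
    (\<forall>t\<ge>0. \<forall>j. (\<lambda>i. pmf \<pi> i * trans_prob P X i j t) sums pmf \<pi> j)"

definition sojourn_time :: "(real \<Rightarrow> 'w \<Rightarrow> nat) \<Rightarrow> nat \<Rightarrow> real \<Rightarrow> 'w \<Rightarrow> ennreal"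
  where "sojourn_time X j t \<omega> = (\<integral>\<^sup>+u\<in>{0..t}. indicator {u. X u \<omega> = j} u \<partial>lborel)"

definition Theta :: "(nat \<Rightarrow> real) \<Rightarrow> nat pmf \<Rightarrow> ennreal"
  where "Theta lam \<pi> =
    (\<Sum>k. inverse (ennreal (lam k * pmf \<pi> k)) * (\<Sum>j. ennreal (pmf \<pi> (k + 1 + j))))"

definition kemeny :: "(nat \<Rightarrow> 'w measure) \<Rightarrow> (real \<Rightarrow> 'w \<Rightarrow> nat) \<Rightarrow> nat pmf \<Rightarrow> ennreal"
  where "kemeny P X \<pi> = (\<Sum>j. ennreal (pmf \<pi> j) * (\<integral>\<^sup>+\<omega>. hitting_time X j \<omega> \<partial>P 0))"

end

theory Submission imports Defs begin

text \<open>Truncate the skeleton chain with step \<open>t / 2 ^ m\<close> to the states up to \<open>n\<close>. By the detailed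
  balance of the rates it is symmetric with respect to \<open>\<beta>\<close> up to an error that vanishes as \<open>m\<close> grows,
  and \<open>n \<rightarrow> \<infinity>\<close> removes the truncation because the paths are bounded on bounded intervals. So the
  process is reversible, first with respect to \<open>\<beta>\<close> and then with respect to \<open>\<pi>\<close>, since \<open>\<pi> / \<beta>\<close> is
  harmonic and hence constant. By reversibility \<open>p\<^sub>j\<^sub>j(t)\<close> decreases to \<open>\<pi>\<^sub>j\<close>, so
  \<open>D\<^sub>j(t) = E\<^sub>j[M\<^sub>j(t)] - \<pi>\<^sub>j t\<close> is nonnegative and increasing in \<open>t\<close>.

  Decomposing at \<open>\<theta>\<^sub>j\<close> shows that \<open>E\<^sub>j[M\<^sub>j(t)] - E\<^sub>i[M\<^sub>j(t)]\<close> tends to \<open>\<pi>\<^sub>j E\<^sub>i[\<theta>\<^sub>j]\<close>, and averaging over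
  \<open>i\<close> that \<open>D\<^sub>j(t)\<close> tends to \<open>\<pi>\<^sub>j E\<^sub>\<pi>[\<theta>\<^sub>j]\<close>. The same limit shows that \<open>i \<mapsto> \<Sum>j. \<pi>\<^sub>j E\<^sub>i[\<theta>\<^sub>j]\<close> is
  superharmonic, hence constant with value \<open>K'\<close>. By monotonicity the sum over \<open>j\<close> of the \<open>D\<^sub>j(t)\<close>
  therefore tends to \<open>\<Sum>j. \<pi>\<^sub>j E\<^sub>\<pi>[\<theta>\<^sub>j] = K'\<close>.\<close>


subsection \<open>Transition probabilities\<close>

lemma suminf_ennreal_sums:
  fixes f :: "nat \<Rightarrow> real"
  assumes "\<And>n. 0 \<le> f n" "f sums x"
  shows "(\<Sum>n. ennreal (f n)) = ennreal x"
  using assms by (metis sums_summable sums_unique suminf_ennreal2)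

context markov_jump_process
begin

abbreviation p :: "nat \<Rightarrow> nat \<Rightarrow> real \<Rightarrow> real" where "p \<equiv> trans_prob P X"

lemma space_P: "space (P i) = space M"
  using sets_P sets_eq_imp_space_eq by blast

lemma measurable_X_P: "0 \<le> t \<Longrightarrow> X t \<in> P i \<rightarrow>\<^sub>M count_space UNIV"
  using measurable_X[of t] measurable_cong_sets[OF sets_P refl] by blast

lemma pred_X_in: "0 \<le> t \<Longrightarrow> Measurable.pred (P i) (\<lambda>\<omega>. X t \<omega> \<in> S)"
  using measurable_X_P[of t i] by measurable

lemma pred_X_eq: "0 \<le> t \<Longrightarrow> Measurable.pred (P i) (\<lambda>\<omega>. X t \<omega> = a)"
  using pred_X_in[of t "{a}" i] by simp

text \<open>Countable additivity over the values of \<open>X t\<close>; this is how an intermediate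
  state is summed out.\<close>

lemma partition_sums:
  assumes t: "0 \<le> t" and Q: "Measurable.pred (P i) Q"
  shows "(\<lambda>a. measure (P i) {\<omega> \<in> space (P i). Q \<omega> \<and> X t \<omega> = a}) sums
           measure (P i) {\<omega> \<in> space (P i). Q \<omega>}"
proof -
  interpret prob_space "P i" by (rule prob_space_P)
  have [measurable]: "X t \<in> P i \<rightarrow>\<^sub>M count_space UNIV" by (rule measurable_X_P[OF t])
  note Q[measurable]
  define A where "A = (\<lambda>a. {\<omega> \<in> space (P i). Q \<omega> \<and> X t \<omega> = a})"
  have "(\<lambda>a. measure (P i) (A a)) sums measure (P i) (\<Union>a. A a)"
    by (rule finite_measure_UNION) (auto simp: A_def disjoint_family_on_def)
  moreover have "(\<Union>a. A a) = {\<omega> \<in> space (P i). Q \<omega>}" by (auto simp: A_def)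
  ultimately show ?thesis by (simp add: A_def)
qed

text \<open>Summing \<open>markov_property\<close> over past values relaxes the condition on the
  past from points to sets. Later the sets are \<open>{..n}\<close> (not above \<open>n\<close>) and
  \<open>- {j}\<close> (not in \<open>j\<close>), at grid times.\<close>

lemma markov_sets:
  fixes \<tau> :: "nat \<Rightarrow> real" and S :: "nat \<Rightarrow> nat set"
  assumes "0 \<le> \<tau> 0" and mono: "\<And>k. k < n \<Longrightarrow> \<tau> k \<le> \<tau> (Suc k)" and s: "0 \<le> s"
  shows "measure (P i) {\<omega> \<in> space (P i). (\<forall>k<n. X (\<tau> k) \<omega> \<in> S k) \<and> X (\<tau> n) \<omega> = x \<and> X (\<tau> n + s) \<omega> = y}
    = measure (P i) {\<omega> \<in> space (P i). (\<forall>k<n. X (\<tau> k) \<omega> \<in> S k) \<and> X (\<tau> n) \<omega> = x} * p x y s"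
proof -
  have pos: "k \<le> n \<Longrightarrow> 0 \<le> \<tau> k" for k
  proof (induction k)
    case (Suc k) then show ?case using mono[of k] by auto
  qed (use assms in simp)
  note [measurable] = pred_X_in pred_X_eq
  have mS: "Measurable.pred (P i) (\<lambda>\<omega>. \<forall>k<m. X (\<tau> k) \<omega> \<in> S k)" if "m \<le> n" for m
  proof (intro pred_intros_countable pred_intros_imp')
    fix k assume "k < m" then show "Measurable.pred (P i) (\<lambda>\<omega>. X (\<tau> k) \<omega> \<in> S k)"
      using pos[of k] that by simp
  qed
  have mZ: "Measurable.pred (P i) (\<lambda>\<omega>. \<forall>k. m \<le> k \<and> k \<le> n \<longrightarrow> X (\<tau> k) \<omega> = z k)" for m and z :: "nat \<Rightarrow> nat"
  proof (intro pred_intros_countable pred_intros_imp')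
    fix k assume "m \<le> k \<and> k \<le> n" then show "Measurable.pred (P i) (\<lambda>\<omega>. X (\<tau> k) \<omega> = z k)"
      using pos[of k] by simp
  qed
  \<comment> \<open>Induction on the number \<open>m\<close> of initial times with only a set
    condition; the times from \<open>m\<close> to \<open>n\<close> stay pinned to \<open>z\<close>.
    The step sums over the values \<open>a\<close> of \<open>X (\<tau> m)\<close>. Since
    \<open>m < n\<close> there, replacing \<open>z m\<close> by \<open>a\<close> does not change
    \<open>z n\<close> or the transition factor.\<close>
  have main: "measure (P i) {\<omega> \<in> space (P i). (\<forall>k<m. X (\<tau> k) \<omega> \<in> S k) \<and>
        (\<forall>k. m \<le> k \<and> k \<le> n \<longrightarrow> X (\<tau> k) \<omega> = z k) \<and> X (\<tau> n + s) \<omega> = y}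
    = measure (P i) {\<omega> \<in> space (P i). (\<forall>k<m. X (\<tau> k) \<omega> \<in> S k) \<and>
        (\<forall>k. m \<le> k \<and> k \<le> n \<longrightarrow> X (\<tau> k) \<omega> = z k)} * p (z n) y s"
    if "m \<le> n" for m and z :: "nat \<Rightarrow> nat"
    using that
  proof (induction m arbitrary: z)
    case 0
    then show ?case using markov_property[of \<tau> n s i z y] assms by auto
  next
    case (Suc m)
    define Q where "Q = (\<lambda>\<omega>. (\<forall>k<Suc m. X (\<tau> k) \<omega> \<in> S k) \<and> (\<forall>k. Suc m \<le> k \<and> k \<le> n \<longrightarrow> X (\<tau> k) \<omega> = z k))"
    define R where "R = (\<lambda>(z :: nat \<Rightarrow> nat) \<omega>. (\<forall>k<m. X (\<tau> k) \<omega> \<in> S k) \<and> (\<forall>k. m \<le> k \<and> k \<le> n \<longrightarrow> X (\<tau> k) \<omega> = z k))"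
    have QR: "Q \<omega> \<and> X (\<tau> m) \<omega> = a \<longleftrightarrow> a \<in> S m \<and> R (z(m := a)) \<omega>" for \<omega> a
      using Suc.prems unfolding Q_def R_def
      by (auto simp: less_Suc_eq)
    have [measurable]: "Measurable.pred (P i) Q"
      unfolding Q_def by (intro pred_intros_logic mS mZ Suc.prems)
    have [measurable]: "Measurable.pred (P i) (\<lambda>\<omega>. X (\<tau> n + s) \<omega> = y)"
      using pos[of n] s by simp
    have IH: "measure (P i) {\<omega> \<in> space (P i). R z \<omega> \<and> X (\<tau> n + s) \<omega> = y} =
       measure (P i) {\<omega> \<in> space (P i). R z \<omega>} * p (z n) y s" for z
      unfolding R_def conj_assoc by (rule Suc.IH) (use Suc.prems in simp)
    have eq: "measure (P i) {\<omega> \<in> space (P i). (Q \<omega> \<and> X (\<tau> n + s) \<omega> = y) \<and> X (\<tau> m) \<omega> = a}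
      = measure (P i) {\<omega> \<in> space (P i). Q \<omega> \<and> X (\<tau> m) \<omega> = a} * p (z n) y s" for a
    proof (cases "a \<in> S m")
      case True
      have 1: "{\<omega> \<in> space (P i). (Q \<omega> \<and> X (\<tau> n + s) \<omega> = y) \<and> X (\<tau> m) \<omega> = a} =
         {\<omega> \<in> space (P i). R (z(m := a)) \<omega> \<and> X (\<tau> n + s) \<omega> = y}" using QR[of _ a] True by auto
      have 2: "{\<omega> \<in> space (P i). Q \<omega> \<and> X (\<tau> m) \<omega> = a} =
         {\<omega> \<in> space (P i). R (z(m := a)) \<omega>}" using QR[of _ a] True by auto
      show ?thesis unfolding 1 2 IH using Suc.prems by simp
    next
      case False
      have 1: "{\<omega> \<in> space (P i). (Q \<omega> \<and> X (\<tau> n + s) \<omega> = y) \<and> X (\<tau> m) \<omega> = a} = {}" using QR[of _ a] False by auto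
      have 2: "{\<omega> \<in> space (P i). Q \<omega> \<and> X (\<tau> m) \<omega> = a} = {}" using QR[of _ a] False by auto
      show ?thesis unfolding 1 2 by simp
    qed
    have "(\<lambda>a. measure (P i) {\<omega> \<in> space (P i). (Q \<omega> \<and> X (\<tau> n + s) \<omega> = y) \<and> X (\<tau> m) \<omega> = a}) sums
       measure (P i) {\<omega> \<in> space (P i). Q \<omega> \<and> X (\<tau> n + s) \<omega> = y}"
      by (rule partition_sums) (use pos Suc.prems in auto)
    moreover have "(\<lambda>a. measure (P i) {\<omega> \<in> space (P i). Q \<omega> \<and> X (\<tau> m) \<omega> = a} * p (z n) y s) sums
       (measure (P i) {\<omega> \<in> space (P i). Q \<omega>} * p (z n) y s)"
      by (rule sums_mult2, rule partition_sums) (use pos Suc.prems in auto)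
    ultimately show ?case unfolding eq unfolding Q_def conj_assoc by (rule sums_unique2)
  qed
  have eq: "(\<forall>k. n \<le> k \<and> k \<le> n \<longrightarrow> X (\<tau> k) \<omega> = x) \<longleftrightarrow> X (\<tau> n) \<omega> = x" for \<omega>
    by (auto dest: antisym)
  show ?thesis using main[of n "\<lambda>_. x"] by (simp only: eq)
qed

lemma p_nonneg [simp]: "0 \<le> p i j t" by (simp add: trans_prob_def)

lemma p_le_1 [simp]: "p i j t \<le> 1"
  by (simp add: trans_prob_def prob_space.prob_le_1[OF prob_space_P])

lemma p_row: "0 \<le> t \<Longrightarrow> (\<lambda>j. p i j t) sums 1"
  using partition_sums[of t "\<lambda>_. True" i] prob_space.prob_space[OF prob_space_P[of i]]
  by (simp add: trans_prob_def)

lemma p_zero: "p i j 0 = (if i = j then 1 else 0)"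
proof -
  interpret prob_space "P i" by (rule prob_space_P)
  have "p i j 0 = measure (P i) {\<omega> \<in> space (P i). i = j}"
    unfolding trans_prob_def
    by (rule measure_eq_AE) (use start[of i] measurable_X_P[of 0 i] in auto)
  then show ?thesis using prob_space by auto
qed

lemma chapman_kolmogorov:
  assumes "0 \<le> s" "0 \<le> t"
  shows "(\<lambda>k. p i k s * p k j t) sums p i j (s + t)"
proof -
  have [measurable]: "X (s + t) \<in> P i \<rightarrow>\<^sub>M count_space UNIV" by (rule measurable_X_P) (use assms in simp)
  have "(\<lambda>a. measure (P i) {\<omega> \<in> space (P i). X (s + t) \<omega> = j \<and> X s \<omega> = a}) sums p i j (s + t)"
    unfolding trans_prob_def by (rule partition_sums) (use assms in auto)
  then show ?thesis
    using markov_sets[of "\<lambda>_. s" 0 t i "\<lambda>_. UNIV" _ j] assms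
    by (simp add: trans_prob_def conj_commute)
qed

lemma p_row_ennreal: "0 \<le> t \<Longrightarrow> (\<Sum>j. ennreal (p i j t)) = 1"
  unfolding ennreal_1[symmetric] by (rule suminf_ennreal_sums[OF p_nonneg p_row])

lemma chapman_kolmogorov_ennreal:
  "0 \<le> s \<Longrightarrow> 0 \<le> t \<Longrightarrow> (\<Sum>k. ennreal (p i k s) * ennreal (p k j t)) = ennreal (p i j (s + t))"
  unfolding ennreal_mult'[OF p_nonneg, symmetric]
  by (rule suminf_ennreal_sums[OF mult_nonneg_nonneg[OF p_nonneg p_nonneg] chapman_kolmogorov])

lemma p_prod_le:
  assumes "0 \<le> s" "0 \<le> t" shows "p i k s * p k j t \<le> p i j (s + t)"
proof -
  have "(\<Sum>k\<in>{k}. p i k s * p k j t) \<le> (\<Sum>k. p i k s * p k j t)"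
    using chapman_kolmogorov[OF assms, of i j] by (intro sum_le_suminf) (auto intro: sums_summable)
  then show ?thesis using sums_unique[OF chapman_kolmogorov[OF assms, of i j]] by simp
qed

text \<open>Compactness of the interval: right-continuity and the left limit make the path constant
  on each side of a time, hence locally bounded. This is non-explosion in the form that later
  removes the truncation.\<close>

lemma path_bounded:
  assumes "\<omega> \<in> space M" "0 \<le> t"
  shows "\<exists>n. \<forall>s. 0 \<le> s \<and> s \<le> t \<longrightarrow> X s \<omega> \<le> n"
proof -
  \<comment> \<open>The guard \<open>0 \<le> s\<close> belongs to the predicate because bisection
    intervals around \<open>0\<close> may reach negative times, where paths are unconstrained. The
    instance with left end \<open>0\<close> repeats it.\<close>
  have "\<exists>n. \<forall>s. 0 \<le> s \<and> 0 \<le> s \<and> s \<le> t \<longrightarrow> X s \<omega> \<le> n"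
    using \<open>0 \<le> t\<close>
  proof (rule Bolzano[where P="\<lambda>a b. \<exists>n. \<forall>s. 0 \<le> s \<and> a \<le> s \<and> s \<le> b \<longrightarrow> X s \<omega> \<le> n"])
    fix a b c
    assume "\<exists>n. \<forall>s. 0 \<le> s \<and> a \<le> s \<and> s \<le> b \<longrightarrow> X s \<omega> \<le> n" "\<exists>n. \<forall>s. 0 \<le> s \<and> b \<le> s \<and> s \<le> c \<longrightarrow> X s \<omega> \<le> n"
    then obtain m n where "\<And>s. 0 \<le> s \<Longrightarrow> a \<le> s \<Longrightarrow> s \<le> b \<Longrightarrow> X s \<omega> \<le> m"
      "\<And>s. 0 \<le> s \<Longrightarrow> b \<le> s \<Longrightarrow> s \<le> c \<Longrightarrow> X s \<omega> \<le> n" by blast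
    then show "\<exists>n. \<forall>s. 0 \<le> s \<and> a \<le> s \<and> s \<le> c \<longrightarrow> X s \<omega> \<le> n"
      by (intro exI[of _ "max m n"]) (meson le_max_iff_disj linear)
  next
    fix x :: real assume x: "0 \<le> x" "x \<le> t"
    obtain b where b: "x < b" "\<And>s. x < s \<Longrightarrow> s < b \<Longrightarrow> X s \<omega> = X x \<omega>"
      using right_continuous_paths[OF assms(1) x(1)] by (auto simp: eventually_at_right_field)
    obtain a k where a: "a < x" "\<And>s. 0 \<le> s \<Longrightarrow> a < s \<Longrightarrow> s < x \<Longrightarrow> X s \<omega> \<le> k"
    proof (cases "x = 0")
      case True then show ?thesis using that[of "-1" 0] by auto
    next
      case False
      then show ?thesis using left_limits_paths[OF assms(1), of x] x that
        by (auto simp: eventually_at_left_field) (metis order_refl)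
    qed
    show "\<exists>d>0. \<forall>a b. a \<le> x \<and> x \<le> b \<and> b - a < d \<longrightarrow> (\<exists>n. \<forall>s. 0 \<le> s \<and> a \<le> s \<and> s \<le> b \<longrightarrow> X s \<omega> \<le> n)"
    proof (intro exI[of _ "min (b - x) (x - a)"] conjI allI impI exI[of _ "max k (X x \<omega>)"])
      show "0 < min (b - x) (x - a)" using a b by auto
      fix a' b' s assume "a' \<le> x \<and> x \<le> b' \<and> b' - a' < min (b - x) (x - a)" "0 \<le> s \<and> a' \<le> s \<and> s \<le> b'"
      then show "X s \<omega> \<le> max k (X x \<omega>)"
        using a(2)[of s] b(2)[of s] by (cases s x rule: linorder_cases) auto
    qed
  qed
  then show ?thesis by simp
qed

end

subsection \<open>Reversibility with respect to the weights \<open>\<beta>\<close>\<close>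

text \<open>Only the states passed before the last step are confined to \<open>{..n}\<close>; the
  column \<open>j\<close> may be any state, as for a chain killed when it moves on from a state
  above \<open>n\<close>.\<close>

primrec killed_power :: "nat \<Rightarrow> (nat \<Rightarrow> nat \<Rightarrow> real) \<Rightarrow> nat \<Rightarrow> nat \<Rightarrow> nat \<Rightarrow> real" where
  "killed_power n A 0 i j = of_bool (i = j)"
| "killed_power n A (Suc N) i j = (\<Sum>k\<le>n. killed_power n A N i k * A k j)"

text \<open>Peels off the first factor, where the recursion peels off the last. Both indices lie in
  the truncated range so that the identity matrix at \<open>N = 0\<close> acts as a unit
  there.\<close>

lemma killed_power_Suc_left:
  assumes "i \<le> n" "j \<le> n"
  shows "killed_power n A (Suc N) i j = (\<Sum>k\<le>n. A i k * killed_power n A N k j)"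
  using \<open>j \<le> n\<close>
proof (induction N arbitrary: j)
  case 0
  have "(\<Sum>k\<le>n. of_bool (i = k) * A k j) = (\<Sum>k\<le>n. if k = i then A i j else 0)"
    by (intro sum.cong) auto
  moreover have "(\<Sum>k\<le>n. A i k * of_bool (k = j)) = (\<Sum>k\<le>n. if k = j then A i j else 0)"
    by (intro sum.cong) auto
  ultimately show ?case using 0 assms(1) by simp
next
  case (Suc N)
  have "killed_power n A (Suc (Suc N)) i j = (\<Sum>k\<le>n. killed_power n A (Suc N) i k * A k j)"
    by (rule killed_power.simps)
  also have "\<dots> = (\<Sum>k\<le>n. (\<Sum>l\<le>n. A i l * killed_power n A N l k) * A k j)"
    by (intro sum.cong) (use Suc.IH in auto)
  also have "\<dots> = (\<Sum>k\<le>n. \<Sum>l\<le>n. A i l * (killed_power n A N l k * A k j))"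
    by (simp add: sum_distrib_right mult.assoc)
  also have "\<dots> = (\<Sum>l\<le>n. \<Sum>k\<le>n. A i l * (killed_power n A N l k * A k j))"
    by (rule sum.swap)
  also have "\<dots> = (\<Sum>l\<le>n. A i l * killed_power n A (Suc N) l j)"
    by (simp add: sum_distrib_left)
  finally show ?case .
qed

lemma killed_power_nonneg: "(\<And>k j. 0 \<le> A k j) \<Longrightarrow> 0 \<le> killed_power n A N i j"
  by (induction N arbitrary: j) (auto intro!: sum_nonneg)

lemma killed_power_row_le:
  assumes "\<And>k j. 0 \<le> A k j" "\<And>k. k \<le> n \<Longrightarrow> (\<Sum>j\<le>n. A k j) \<le> (1::real)"
  shows "(\<Sum>j\<le>n. killed_power n A N i j) \<le> 1"
proof (induction N)
  case 0
  have "(\<Sum>j\<le>n. of_bool (i = j)) = (\<Sum>j\<le>n. if j = i then 1 else (0::real))" by (intro sum.cong) auto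
  then show ?case by simp
next
  case (Suc N)
  have "(\<Sum>j\<le>n. killed_power n A (Suc N) i j) = (\<Sum>k\<le>n. \<Sum>j\<le>n. killed_power n A N i k * A k j)"
    by (simp, rule sum.swap)
  also have "\<dots> = (\<Sum>k\<le>n. killed_power n A N i k * (\<Sum>j\<le>n. A k j))"
    by (simp add: sum_distrib_left)
  also have "\<dots> \<le> (\<Sum>k\<le>n. killed_power n A N i k * 1)"
    by (intro sum_mono mult_left_mono) (use assms killed_power_nonneg[of A n N i] in auto)
  finally show ?case using Suc by simp
qed

text \<open>Each further factor adds at most one copy of the one-step asymmetry, because rows of
  \<open>A\<close> and of its truncated powers sum to at most one. Linear growth in \<open>N\<close>
  is affordable: with \<open>N\<close> steps of length \<open>t / N\<close>, a one-step asymmetry of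
  order o(\<open>t / N\<close>) still vanishes.\<close>

lemma killed_power_almost_symmetric:
  fixes b :: "nat \<Rightarrow> real"
  assumes A: "\<And>k j. 0 \<le> A k j" and row: "\<And>k. k \<le> n \<Longrightarrow> (\<Sum>j\<le>n. A k j) \<le> 1"
  shows "(\<Sum>i\<le>n. \<Sum>j\<le>n. \<bar>b i * killed_power n A N i j - b j * killed_power n A N j i\<bar>)
     \<le> real N * (\<Sum>i\<le>n. \<Sum>j\<le>n. \<bar>b i * A i j - b j * A j i\<bar>)"
proof (induction N)
  case 0
  have "b i * of_bool (i = j) - b j * of_bool (j = i) = 0" for i j by auto
  then show ?case by simp
next
  case (Suc N)
  let ?a = "killed_power n A N"
  have a_nonneg: "0 \<le> ?a k i" for k i by (rule killed_power_nonneg) (rule A)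
  define x where "x = (\<lambda>i k. \<bar>b i * ?a i k - b k * ?a k i\<bar>)"
  define d where "d = (\<lambda>k j. \<bar>b k * A k j - b j * A j k\<bar>)"
  have bound: "\<bar>b i * killed_power n A (Suc N) i j - b j * killed_power n A (Suc N) j i\<bar>
      \<le> (\<Sum>k\<le>n. x i k * A k j) + (\<Sum>k\<le>n. ?a k i * d k j)" if "i \<le> n" "j \<le> n" for i j
  proof -
    \<comment> \<open>One power is expanded at its last factor, the other at its first;
      \<open>b k * ?a k i * A k j\<close> is then subtracted and added.\<close>
    have eq: "b i * killed_power n A (Suc N) i j - b j * killed_power n A (Suc N) j i =
      (\<Sum>k\<le>n. (b i * ?a i k - b k * ?a k i) * A k j + ?a k i * (b k * A k j - b j * A j k))"
      unfolding killed_power_Suc_left[OF that(2,1)]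
      unfolding killed_power.simps sum_distrib_left sum_subtractf[symmetric]
      by (intro sum.cong) (auto simp: algebra_simps)
    have "\<bar>b i * killed_power n A (Suc N) i j - b j * killed_power n A (Suc N) j i\<bar>
      \<le> (\<Sum>k\<le>n. \<bar>(b i * ?a i k - b k * ?a k i) * A k j + ?a k i * (b k * A k j - b j * A j k)\<bar>)"
      unfolding eq by (rule sum_abs)
    also have "\<dots> \<le> (\<Sum>k\<le>n. x i k * A k j + ?a k i * d k j)"
    proof (rule sum_mono)
      fix k
      show "\<bar>(b i * ?a i k - b k * ?a k i) * A k j + ?a k i * (b k * A k j - b j * A j k)\<bar>
          \<le> x i k * A k j + ?a k i * d k j"
        using abs_triangle_ineq[of "(b i * ?a i k - b k * ?a k i) * A k j" "?a k i * (b k * A k j - b j * A j k)"]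
        unfolding x_def d_def abs_mult abs_of_nonneg[OF A] abs_of_nonneg[OF a_nonneg] .
    qed
    finally show ?thesis by (simp add: sum.distrib)
  qed
  have "(\<Sum>i\<le>n. \<Sum>j\<le>n. \<bar>b i * killed_power n A (Suc N) i j - b j * killed_power n A (Suc N) j i\<bar>)
     \<le> (\<Sum>i\<le>n. \<Sum>j\<le>n. (\<Sum>k\<le>n. x i k * A k j) + (\<Sum>k\<le>n. ?a k i * d k j))"
    by (intro sum_mono bound) auto
  also have "\<dots> = (\<Sum>i\<le>n. \<Sum>j\<le>n. \<Sum>k\<le>n. x i k * A k j) + (\<Sum>i\<le>n. \<Sum>j\<le>n. \<Sum>k\<le>n. ?a k i * d k j)"
    by (simp add: sum.distrib)
  also have "(\<Sum>i\<le>n. \<Sum>j\<le>n. \<Sum>k\<le>n. x i k * A k j) = (\<Sum>i\<le>n. \<Sum>k\<le>n. x i k * (\<Sum>j\<le>n. A k j))"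
    unfolding sum_distrib_left by (intro sum.cong refl sum.swap)
  also have "\<dots> \<le> (\<Sum>i\<le>n. \<Sum>k\<le>n. x i k * 1)"
    by (intro sum_mono mult_left_mono row) (auto simp: x_def)
  also have "(\<Sum>i\<le>n. \<Sum>j\<le>n. \<Sum>k\<le>n. ?a k i * d k j) = (\<Sum>i\<le>n. \<Sum>k\<le>n. \<Sum>j\<le>n. ?a k i * d k j)"
    by (intro sum.cong refl sum.swap)
  also have "\<dots> = (\<Sum>k\<le>n. \<Sum>i\<le>n. \<Sum>j\<le>n. ?a k i * d k j)"
    by (rule sum.swap)
  also have "\<dots> = (\<Sum>k\<le>n. (\<Sum>i\<le>n. ?a k i) * (\<Sum>j\<le>n. d k j))"
    by (simp add: sum_product)
  also have "\<dots> \<le> (\<Sum>k\<le>n. 1 * (\<Sum>j\<le>n. d k j))"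
    by (intro sum_mono mult_right_mono sum_nonneg killed_power_row_le[OF A row]) (auto simp: d_def)
  finally show ?case using Suc by (simp add: x_def d_def algebra_simps)
qed

text \<open>The Markov property at the last grid time but one reproduces the recursion of
  \<open>killed_power\<close>; the final position \<open>j\<close> is unrestricted on both
  sides.\<close>

lemma (in markov_jump_process) killed_skeleton_prob:
  assumes "0 \<le> h" "i \<le> n"
  shows "measure (P i) {\<omega> \<in> space (P i). (\<forall>l<N. X (real l * h) \<omega> \<le> n) \<and> X (real N * h) \<omega> = j}
    = killed_power n (\<lambda>k j. p k j h) N i j"
proof (induction N arbitrary: j)
  case 0 then show ?case using p_zero[of i j] by (simp add: trans_prob_def)
next
  case (Suc N)
  have m1: "Measurable.pred (P i) (\<lambda>\<omega>. X (real l * h) \<omega> \<le> n)" for l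
    using pred_X_in[of "real l * h" "{..n}" i] assms by simp
  have m2: "Measurable.pred (P i) (\<lambda>\<omega>. X (real l * h) \<omega> = j)" for l
    using pred_X_eq[of "real l * h" j i] assms by simp
  define Q where "Q = (\<lambda>\<omega>. (\<forall>l<Suc N. X (real l * h) \<omega> \<le> n) \<and> X (real (Suc N) * h) \<omega> = j)"
  have "Measurable.pred (P i) Q"
    unfolding Q_def by (intro pred_intros_logic m2 pred_intros_countable pred_intros_imp' m1)
  then have "(\<lambda>a. measure (P i) {\<omega> \<in> space (P i). Q \<omega> \<and> X (real N * h) \<omega> = a}) sums
      measure (P i) {\<omega> \<in> space (P i). Q \<omega>}"
    by (intro partition_sums) (use assms in auto)
  \<comment> \<open>\<open>Q\<close> contains the condition at \<open>l = N\<close>, so the values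
    \<open>a > n\<close> contribute nothing and the series is a finite sum.\<close>
  moreover have "(\<lambda>a. measure (P i) {\<omega> \<in> space (P i). Q \<omega> \<and> X (real N * h) \<omega> = a}) sums
     (\<Sum>a\<le>n. measure (P i) {\<omega> \<in> space (P i). Q \<omega> \<and> X (real N * h) \<omega> = a})"
  proof (rule sums_finite)
    fix a assume "a \<notin> {..n}"
    then have "{\<omega> \<in> space (P i). Q \<omega> \<and> X (real N * h) \<omega> = a} = {}" by (auto simp: Q_def)
    then show "measure (P i) {\<omega> \<in> space (P i). Q \<omega> \<and> X (real N * h) \<omega> = a} = 0"
      by (simp only: measure_empty)
  qed simp
  moreover have "measure (P i) {\<omega> \<in> space (P i). Q \<omega> \<and> X (real N * h) \<omega> = a} =
     killed_power n (\<lambda>k j. p k j h) N i a * p a j h" if "a \<le> n" for a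
  proof -
    have "{\<omega> \<in> space (P i). Q \<omega> \<and> X (real N * h) \<omega> = a} =
      {\<omega> \<in> space (P i). (\<forall>l<N. X (real l * h) \<omega> \<in> {..n}) \<and> X (real N * h) \<omega> = a \<and> X (real N * h + h) \<omega> = j}"
      using that by (auto simp: Q_def less_Suc_eq algebra_simps)
    then show ?thesis
      using markov_sets[of "\<lambda>l. real l * h" N h i "\<lambda>_. {..n}" a j] Suc[of a] assms
      by (simp add: algebra_simps)
  qed
  ultimately have "measure (P i) {\<omega> \<in> space (P i). Q \<omega>} =
     (\<Sum>a\<le>n. killed_power n (\<lambda>k j. p k j h) N i a * p a j h)"
    using sums_unique2 by fastforce
  then show ?case by (simp add: Q_def)
qed

section \<open>From balance of the rates to balance of the transition probabilities\<close>

context birth_death_process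
begin

text \<open>The solution of the detailed balance equations of the rates with value 1 at 0, not
  normalised. That \<pi> is proportional to it comes out of the proof of
  \<open>reversible\<close>.\<close>

definition beta :: "nat \<Rightarrow> real" where "beta n = (\<Prod>k<n. lam k / mu (Suc k))"

lemma beta_pos: "0 < beta n"
  unfolding beta_def by (intro prod_pos) (auto simp: birth_rate_pos death_rate_pos)

lemma beta_Suc: "beta (Suc n) * mu (Suc n) = beta n * lam n"
  using death_rate_pos[of "Suc n"] by (simp add: beta_def)

text \<open>The birth and death rates already exhaust the exit rate, and each row sums to one, so
  nothing of first order is left for a non-neighbour.\<close>

lemma far_rate:
  assumes "b \<noteq> a" "b \<noteq> Suc a" "a \<noteq> Suc b"
  shows "((\<lambda>h. p a b h / h) \<longlongrightarrow> 0) (at_right 0)"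
proof (rule tendsto_sandwich[OF _ _ tendsto_const])
  \<comment> \<open>For \<open>a = 0\<close> the truncated difference \<open>a - 1\<close> is
    \<open>a\<close> itself, so the downward term is replaced by 0.\<close>
  let ?d = "\<lambda>h. if a = 0 then 0 else p a (a - 1) h / h"
  have lim_d: "(?d \<longlongrightarrow> (if a = 0 then 0 else mu a)) (at_right 0)"
    using death_rate[of a] by auto
  show "((\<lambda>h. (1 - p a a h) / h - p a (a + 1) h / h - ?d h) \<longlongrightarrow> 0) (at_right 0)"
    using tendsto_diff[OF tendsto_diff[OF exit_rate[of a] birth_rate[of a]] lim_d] by simp
  show "\<forall>\<^sub>F h in at_right 0. 0 \<le> p a b h / h"
    unfolding eventually_at_right_field by (intro exI[of _ 1]) auto
  have "p a b h / h \<le> (1 - p a a h) / h - p a (a + 1) h / h - ?d h" if "0 < h" for h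
  proof -
    have "(\<Sum>j\<in>{a, a + 1, b} \<union> (if a = 0 then {} else {a - 1}). p a j h) \<le> (\<Sum>j. p a j h)"
      using p_row[of h a] that by (intro sum_le_suminf) (auto intro: sums_summable)
    also have "\<dots> = 1" using sums_unique[OF p_row[of h a]] that by simp
    finally have "p a b h + p a a h + p a (a + 1) h + (if a = 0 then 0 else p a (a - 1) h) \<le> 1"
      using assms by (cases a) (auto simp: insert_commute)
    then have "p a b h \<le> 1 - p a a h - p a (a + 1) h - (if a = 0 then 0 else p a (a - 1) h)" by linarith
    then have "p a b h / h \<le> (1 - p a a h - p a (a + 1) h - (if a = 0 then 0 else p a (a - 1) h)) / h"
      using that by (intro divide_right_mono) auto
    then show ?thesis by (cases "a = 0") (simp_all add: diff_divide_distrib)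
  qed
  then show "\<forall>\<^sub>F h in at_right 0. p a b h / h \<le> (1 - p a a h) / h - p a (a + 1) h / h - ?d h"
    unfolding eventually_at_right_field by (intro exI[of _ 1]) auto
qed

text \<open>For neighbours the first-order terms cancel by \<open>beta_Suc\<close>; for states
  further apart both are o(\<open>h\<close>) by \<open>far_rate\<close>.\<close>

lemma detailed_balance_rate:
  "((\<lambda>h. \<bar>beta a * p a b h - beta b * p b a h\<bar> / h) \<longlongrightarrow> 0) (at_right 0)"
proof -
  have step: "((\<lambda>h. beta n * (p n (Suc n) h / h) - beta (Suc n) * (p (Suc n) n h / h)) \<longlongrightarrow> 0) (at_right 0)" for n
    using tendsto_diff[OF tendsto_mult_left[OF birth_rate[of n], of "beta n"]
        tendsto_mult_left[OF death_rate[of "Suc n"], of "beta (Suc n)"]] by (simp add: beta_Suc)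
  have "((\<lambda>h. beta a * (p a b h / h) - beta b * (p b a h / h)) \<longlongrightarrow> 0) (at_right 0)"
  proof -
    consider "a = b" | "b = Suc a" | "a = Suc b" | "b \<noteq> a" "b \<noteq> Suc a" "a \<noteq> Suc b" by blast
    then show ?thesis
    proof cases
      case 3 then show ?thesis using tendsto_minus[OF step[of b]] by simp
    next
      case 4
      then show ?thesis
        using tendsto_diff[OF tendsto_mult_left[OF far_rate[of b a], of "beta a"]
          tendsto_mult_left[OF far_rate[of a b], of "beta b"]] by simp
    qed (use step in auto)
  qed
  then have "((\<lambda>h. \<bar>beta a * (p a b h / h) - beta b * (p b a h / h)\<bar>) \<longlongrightarrow> 0) (at_right 0)"
    by (rule tendsto_rabs_zero)
  moreover have "\<forall>\<^sub>F h in at_right 0. \<bar>beta a * (p a b h / h) - beta b * (p b a h / h)\<bar> = 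
     \<bar>beta a * p a b h - beta b * p b a h\<bar> / h"
    unfolding eventually_at_right_field
    by (intro exI[of _ 1]) (auto simp: diff_divide_distrib[symmetric] abs_divide)
  ultimately show ?thesis by (rule Lim_transform_eventually)
qed

lemma dyadic_step_tendsto: "0 < t \<Longrightarrow> filterlim (\<lambda>m. t / 2 ^ m) (at_right (0::real)) sequentially"
  unfolding filterlim_at
  by (auto intro!: always_eventually tendsto_divide_0[OF tendsto_const] filterlim_at_top_imp_at_infinity
      filterlim_realpow_sequentially_gt1)

text \<open>The order of limits matters: for fixed \<open>n\<close> finitely many pairs of states
  occur, so the o(\<open>h\<close>) errors can be summed. The mesh goes to zero first, and only then
  does \<open>n\<close> grow.\<close>

lemma beta_reversible: 
  assumes "0 \<le> t"
  shows "beta i * p i j t = beta j * p j i t"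
proof (cases "t = 0")
  case True then show ?thesis by (simp add: p_zero)
next
  case False
  with assms have t: "0 < t" by simp
  \<comment> \<open>\<open>E\<close> restricts the path at the grid times of level \<open>m\<close>
    before \<open>t\<close>, and \<open>F\<close> at those of all levels. \<open>F\<close> is thus
    the decreasing limit of \<open>E\<close> in \<open>m\<close>.\<close>
  define E where "E = (\<lambda>n m i j. {\<omega> \<in> space (P i). (\<forall>l<2^m. X (real l * (t / 2^m)) \<omega> \<le> n) \<and> X t \<omega> = j})"
  define F where "F = (\<lambda>n i j. {\<omega> \<in> space (P i). (\<forall>m. \<forall>l<2^m. X (real l * (t / 2^m)) \<omega> \<le> n) \<and> X t \<omega> = j})"
  have m1: "Measurable.pred (P i) (\<lambda>\<omega>. X s \<omega> \<le> n)" if "0 \<le> s" for s i n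
    using pred_X_in[OF that, of "{..n}" i] by simp
  have m2: "Measurable.pred (P i) (\<lambda>\<omega>. X t \<omega> = j)" for i j
    using pred_X_eq[of t j i] t by simp
  have E_sets: "E n m i j \<in> sets (P i)" for n m i j
    unfolding E_def
    by (intro predE pred_intros_logic m2 pred_intros_countable pred_intros_imp' m1) (use t in auto)
  have F_sets: "F n i j \<in> sets (P i)" for n i j
    unfolding F_def
    by (intro predE pred_intros_logic m2 pred_intros_countable pred_intros_imp' m1) (use t in auto)
  have E_lim: "(\<lambda>m. measure (P i) (E n m i j)) \<longlonglongrightarrow> measure (P i) (F n i j)" for n i j
  proof -
    interpret prob_space "P i" by (rule prob_space_P)
    have "decseq (\<lambda>m. E n m i j)"
    proof (rule decseq_SucI, rule subsetI)
      fix m \<omega> assume \<omega>: "\<omega> \<in> E n (Suc m) i j"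
      \<comment> \<open>Dyadic grids are nested: point \<open>l\<close> of level \<open>m\<close> is
        point \<open>2 * l\<close> of the next level.\<close>
      have "X (real l * (t / 2^m)) \<omega> \<le> n" if "l < 2^m" for l
      proof -
        have "X (real (2 * l) * (t / 2^Suc m)) \<omega> \<le> n"
          using \<omega> that unfolding E_def by (metis (mono_tags, lifting) mem_Collect_eq nat_mult_less_cancel1 pos2 power_Suc)
        then show ?thesis by simp
      qed
      with \<omega> show "\<omega> \<in> E n m i j" by (auto simp: E_def)
    qed
    moreover have "(\<Inter>m. E n m i j) = F n i j" by (auto simp: E_def F_def)
    moreover have "range (\<lambda>m. E n m i j) \<subseteq> sets (P i)" using E_sets by (rule image_subsetI)
    ultimately show ?thesis
      using finite_Lim_measure_decseq[of "\<lambda>m. E n m i j"] by simp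
  qed
  have F_lim: "(\<lambda>n. measure (P i) (F n i j)) \<longlonglongrightarrow> p i j t" for i j
  proof -
    interpret prob_space "P i" by (rule prob_space_P)
    \<comment> \<open>A path bounded by \<open>n\<close> on \<open>[0, t]\<close> lies in
      \<open>F n\<close>, so the truncation disappears as \<open>n\<close> grows.\<close>
    have "(\<Union>n. F n i j) = {\<omega> \<in> space (P i). X t \<omega> = j}"
    proof (intro set_eqI iffI)
      fix \<omega> assume \<omega>: "\<omega> \<in> {\<omega> \<in> space (P i). X t \<omega> = j}"
      then obtain n where n: "\<And>s. 0 \<le> s \<Longrightarrow> s \<le> t \<Longrightarrow> X s \<omega> \<le> n"
        using path_bounded[of \<omega> t] t space_P by auto
      have "X (real l * (t / 2^m)) \<omega> \<le> n" if "l < 2^m" for l m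
      proof (rule n)
        have "real l \<le> 2^m" using that by (metis less_imp_le of_nat_le_iff of_nat_numeral of_nat_power)
        then show "real l * (t / 2^m) \<le> t" using t by (simp add: field_simps)
      qed (use t in simp)
      then show "\<omega> \<in> (\<Union>n. F n i j)" using \<omega> by (auto simp: F_def)
    qed (auto simp: F_def)
    moreover have "incseq (\<lambda>n. F n i j)" by (rule incseq_SucI) (auto simp: F_def le_Suc_eq)
    moreover have "range (\<lambda>n. F n i j) \<subseteq> sets (P i)" using F_sets by (rule image_subsetI)
    ultimately show ?thesis
      using finite_Lim_measure_incseq[of "\<lambda>n. F n i j"] by (simp add: trans_prob_def)
  qed
  have F_sym: "beta i * measure (P i) (F n i j) = beta j * measure (P j) (F n j i)" if "i \<le> n" "j \<le> n" for n
  proof -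
    define D where "D = (\<lambda>h. \<Sum>i\<le>n. \<Sum>j\<le>n. \<bar>beta i * p i j h - beta j * p j i h\<bar> / h)"
    have "(D \<longlongrightarrow> (\<Sum>i\<le>n. \<Sum>j\<le>n. 0)) (at_right 0)"
      unfolding D_def by (intro tendsto_sum detailed_balance_rate)
    then have "(\<lambda>m. D (t / 2^m)) \<longlonglongrightarrow> 0"
      using filterlim_compose[OF _ dyadic_step_tendsto[OF t]] by (metis sum.neutral_const)
    then have D_lim: "(\<lambda>m. t * D (t / 2^m)) \<longlonglongrightarrow> 0" by (rule tendsto_mult_right_zero)
    \<comment> \<open>There are \<open>2^m\<close> steps of length \<open>h = t / 2^m\<close>. The
      linear bound \<open>2^m\<close> times the one-step asymmetry \<open>h * D h\<close> is
      \<open>t * D h\<close>.\<close>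
    have bound: "\<bar>beta i * measure (P i) (E n m i j) - beta j * measure (P j) (E n m j i)\<bar> \<le> t * D (t / 2^m)" for m
    proof -
      define h where "h = t / 2^m"
      have h: "0 < h" "real (2^m) * h = t" using t by (auto simp: h_def)
      define A where "A = (\<lambda>k j. p k j h)"
      have row: "(\<Sum>j\<le>n. A k j) \<le> 1" for k
      proof -
        have "(\<Sum>j\<le>n. p k j h) \<le> (\<Sum>j. p k j h)"
          using p_row[of h k] h by (intro sum_le_suminf) (auto intro: sums_summable)
        then show ?thesis using sums_unique[OF p_row[of h k]] h by (simp add: A_def)
      qed
      have E_eq: "measure (P a) (E n m a b) = killed_power n A (2^m) a b" if "a \<le> n" for a b
        using killed_skeleton_prob[of h a n "2^m" b] that h unfolding E_def A_def h_def[symmetric] by simp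
      let ?f = "\<lambda>a b. \<bar>beta a * killed_power n A (2^m) a b - beta b * killed_power n A (2^m) b a\<bar>"
      have "?f i j \<le> (\<Sum>b\<le>n. ?f i b)" using that by (intro member_le_sum) auto
      also have "\<dots> \<le> (\<Sum>a\<le>n. \<Sum>b\<le>n. ?f a b)"
        using that by (intro member_le_sum[of i "{..n}" "\<lambda>a. \<Sum>b\<le>n. ?f a b"]) (auto intro: sum_nonneg)
      also have "\<dots> \<le> real (2^m) * (\<Sum>a\<le>n. \<Sum>b\<le>n. \<bar>beta a * A a b - beta b * A b a\<bar>)"
        by (rule killed_power_almost_symmetric) (auto simp: row, simp add: A_def)
      also have "\<dots> = real (2^m) * h * D h"
        using h(1) by (simp add: D_def A_def sum_divide_distrib[symmetric])
      finally show ?thesis using h E_eq that by (simp add: h_def)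
    qed
    have "(\<lambda>m. \<bar>beta i * measure (P i) (E n m i j) - beta j * measure (P j) (E n m j i)\<bar>) \<longlonglongrightarrow> 0"
      by (rule tendsto_sandwich[OF _ _ tendsto_const D_lim]) (auto intro!: always_eventually bound)
    moreover have "(\<lambda>m. \<bar>beta i * measure (P i) (E n m i j) - beta j * measure (P j) (E n m j i)\<bar>) \<longlonglongrightarrow>
      \<bar>beta i * measure (P i) (F n i j) - beta j * measure (P j) (F n j i)\<bar>"
      by (intro tendsto_intros E_lim)
    ultimately show ?thesis using LIMSEQ_unique by fastforce
  qed
  have "\<forall>\<^sub>F n in sequentially. beta i * measure (P i) (F n i j) = beta j * measure (P j) (F n j i)"
    using eventually_ge_at_top[of "max i j"] by eventually_elim (use F_sym in auto)
  then have "(\<lambda>n. beta j * measure (P j) (F n j i)) \<longlonglongrightarrow> beta i * p i j t"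
    by (rule Lim_transform_eventually[OF tendsto_mult_left[OF F_lim]])
  then show ?thesis using tendsto_mult_left[OF F_lim[of j i], of "beta j"] LIMSEQ_unique by blast
qed

end

subsection \<open>The stationary distribution\<close>

lemma suminf_swap_ennreal:
  fixes f :: "nat \<Rightarrow> nat \<Rightarrow> ennreal"
  shows "(\<Sum>i. \<Sum>j. f i j) = (\<Sum>j. \<Sum>i. f i j)"
proof -
  have "(\<Sum>i. \<Sum>j. f i j) = (\<integral>\<^sup>+i. (\<Sum>j. f i j) \<partial>count_space UNIV)"
    by (simp add: nn_integral_count_space_nat)
  also have "\<dots> = (\<Sum>j. \<integral>\<^sup>+i. f i j \<partial>count_space UNIV)"
    by (rule nn_integral_suminf) simp
  finally show ?thesis by (simp add: nn_integral_count_space_nat)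
qed

lemma suminf_mono_ennreal:
  fixes f g :: "nat \<Rightarrow> ennreal"
  shows "(\<And>n. f n \<le> g n) \<Longrightarrow> suminf f \<le> suminf g"
  by (rule suminf_le) auto

text \<open>The differences \<open>b n - a n\<close> sum to zero once the finite common sum is
  cancelled.\<close>

lemma suminf_eq_imp_eq_ennreal:
  fixes a b :: "nat \<Rightarrow> ennreal"
  assumes le: "\<And>n. a n \<le> b n" and eq: "suminf a = suminf b" and fin: "suminf b \<noteq> \<top>"
  shows "a n = b n"
proof -
  have "(\<Sum>n. (b n - a n)) + suminf a = (\<Sum>n. (b n - a n) + a n)"
    by (rule suminf_add) auto
  also have "\<dots> = suminf b" using le by (simp add: diff_add_cancel_ennreal)
  finally have "suminf b + (\<Sum>n. (b n - a n)) = suminf b + 0"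
    using eq by (simp add: add.commute)
  then have "(\<Sum>n. (b n - a n)) = 0"
    using fin unfolding ennreal_add_left_cancel by simp
  then have "b n - a n = 0" by (simp add: suminf_eq_zero_iff)
  then have "b n = a n" using diff_add_cancel_ennreal[OF le[of n]] by simp
  then show ?thesis ..
qed

lemma two_mult_le_squares_ennreal:
  fixes a b :: ennreal
  assumes "a \<noteq> \<top>" "b \<noteq> \<top>"
  shows "2 * a * b \<le> a\<^sup>2 + b\<^sup>2"
proof -
  obtain x y where xy: "0 \<le> x" "0 \<le> y" "a = ennreal x" "b = ennreal y"
    using assms by (metis ennreal_cases)
  have "2 * x * y \<le> x\<^sup>2 + y\<^sup>2" using sum_squares_bound by auto
  then have "ennreal (2 * x * y) \<le> ennreal (x\<^sup>2 + y\<^sup>2)" by (rule ennreal_leI)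
  then show ?thesis using xy by (simp add: ennreal_mult ennreal_power ennreal_plus)
qed

text \<open>Jensen's inequality for the square and the probability weights \<open>q\<close>. With
  \<open>a\<close> the mean, the bound \<open>2 * a * g k\<close> by the sum of the two squares
  replaces the expansion of the variance, which would need subtraction; \<open>a\<close> is finite
  and cancels at the end.\<close>

lemma suminf_square_le_ennreal:
  fixes q g :: "nat \<Rightarrow> ennreal"
  assumes q: "suminf q = 1" and g: "\<And>k. g k \<le> 1"
  shows "(\<Sum>k. q k * g k)\<^sup>2 \<le> (\<Sum>k. q k * (g k)\<^sup>2)"
proof -
  define a where "a = (\<Sum>k. q k * g k)"
  have "a \<le> (\<Sum>k. q k * 1)" unfolding a_def by (intro suminf_mono_ennreal mult_left_mono g) auto
  then have a: "a \<noteq> \<top>" using q by (auto simp: top_unique)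
  have g': "g k \<noteq> \<top>" for k using g[of k] by (auto simp: top_unique)
  have "a\<^sup>2 + a\<^sup>2 = (\<Sum>k. q k * (2 * a * g k))"
  proof -
    have "(\<Sum>k. q k * (2 * a * g k)) = (\<Sum>k. (2 * a) * (q k * g k))" by (simp add: ac_simps)
    also have "\<dots> = 2 * a * a" unfolding a_def by (rule ennreal_suminf_cmult)
    finally show ?thesis by (simp add: power2_eq_square mult_2 distrib_right)
  qed
  also have "\<dots> \<le> (\<Sum>k. q k * (a\<^sup>2 + (g k)\<^sup>2))"
    by (intro suminf_mono_ennreal mult_left_mono two_mult_le_squares_ennreal a g') auto
  also have "\<dots> = (\<Sum>k. q k * a\<^sup>2) + (\<Sum>k. q k * (g k)\<^sup>2)"
    by (simp add: distrib_left suminf_add[symmetric])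
  also have "(\<Sum>k. q k * a\<^sup>2) = a\<^sup>2" using q by (simp add: ennreal_suminf_multc)
  finally have "a\<^sup>2 \<le> (\<Sum>k. q k * (g k)\<^sup>2)"
    using a by (simp add: ennreal_add_left_cancel_le power2_eq_square ennreal_mult_eq_top_iff)
  then show ?thesis by (simp add: a_def)
qed

section \<open>Superharmonic functions and reversibility with respect to \<pi>\<close>

locale stationary_birth_death_process = birth_death_process M P X lam mu
  for M :: "'w measure" and P :: "nat \<Rightarrow> 'w measure" and X :: "real \<Rightarrow> 'w \<Rightarrow> nat"
    and lam mu :: "nat \<Rightarrow> real" +
  fixes \<pi> :: "nat pmf"
  assumes irreducible: "irreducible_process P X"
    and stationary: "stationary_distribution P X \<pi>"
begin

lemma stationary_suminf:
  "0 \<le> t \<Longrightarrow> (\<Sum>i. ennreal (pmf \<pi> i) * ennreal (p i j t)) = ennreal (pmf \<pi> j)"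
  unfolding ennreal_mult'[OF pmf_nonneg, symmetric]
  by (rule suminf_ennreal_sums) (use stationary in \<open>auto simp: stationary_distribution_def\<close>)

lemma pmf_suminf: "(\<Sum>i. ennreal (pmf \<pi> i)) = 1"
  using nn_integral_pmf[where p=\<pi> and A=UNIV] by (simp add: nn_integral_count_space_nat)

text \<open>Some state has positive mass, and irreducibility with stationarity passes part of it on
  to \<open>j\<close>.\<close>

lemma pmf_pos: "0 < pmf \<pi> j"
proof -
  obtain i where i: "0 < pmf \<pi> i"
    using set_pmf_not_empty[of \<pi>] by (metis ex_in_conv pmf_positive)
  obtain t where t: "0 \<le> t" "0 < p i j t"
    using irreducible by (auto simp: irreducible_process_def)
  have "0 < pmf \<pi> i * p i j t" using i t by simp
  also have "pmf \<pi> i * p i j t = (\<Sum>i\<in>{i}. pmf \<pi> i * p i j t)" by simp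
  also have "\<dots> \<le> (\<Sum>i. pmf \<pi> i * p i j t)"
    using stationary t by (intro sum_le_suminf) (auto simp: stationary_distribution_def intro: sums_summable)
  also have "\<dots> = pmf \<pi> j"
    using stationary t by (auto simp: stationary_distribution_def dest: sums_unique[symmetric])
  finally show ?thesis by simp
qed

text \<open>Truncating at a level \<open>c\<close> keeps \<open>u\<close> superharmonic and makes it \<open>\<pi>\<close>-integrable, and an integrable
  superharmonic function is harmonic because \<open>\<pi>\<close> is stationary. A harmonic function that attains its
  maximum \<open>c\<close> somewhere equals \<open>c\<close> everywhere.\<close>

lemma superharmonic_const:
  fixes u :: "nat \<Rightarrow> ennreal"
  assumes super: "\<And>t i. 0 \<le> t \<Longrightarrow> (\<Sum>k. ennreal (p i k t) * u k) \<le> u i"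
  shows "u i = u j"
proof -
  have trunc: "c \<le> u j" if c: "c \<le> u i" "c \<noteq> \<top>" for c i j
  proof -
    obtain t where t: "0 \<le> t" "0 < p i j t"
      using irreducible by (auto simp: irreducible_process_def)
    define v where "v = (\<lambda>k. min (u k) c)"
    define w where "w = (\<lambda>k. \<Sum>l. ennreal (p k l t) * v l)"
    have wv: "w k \<le> v k" for k
    proof -
      have "w k \<le> (\<Sum>l. ennreal (p k l t) * u l)"
        unfolding w_def v_def by (intro suminf_mono_ennreal mult_left_mono) auto
      also have "\<dots> \<le> u k" by (rule super[OF t(1)])
      finally have "w k \<le> u k" .
      moreover have "w k \<le> (\<Sum>l. ennreal (p k l t) * c)"
        unfolding w_def v_def by (intro suminf_mono_ennreal mult_left_mono) auto
      ultimately show ?thesis using p_row_ennreal[OF t(1), of k] by (simp add: v_def ennreal_suminf_multc)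
    qed
    have "(\<Sum>k. ennreal (pmf \<pi> k) * w k) = (\<Sum>k. \<Sum>l. ennreal (pmf \<pi> k) * (ennreal (p k l t) * v l))"
      by (simp add: w_def)
    also have "\<dots> = (\<Sum>l. \<Sum>k. ennreal (pmf \<pi> k) * ennreal (p k l t) * v l)"
      by (subst suminf_swap_ennreal) (simp add: mult.assoc)
    also have "\<dots> = (\<Sum>l. ennreal (pmf \<pi> l) * v l)"
      by (simp add: ennreal_suminf_multc stationary_suminf[OF t(1)])
    finally have eq: "(\<Sum>k. ennreal (pmf \<pi> k) * w k) = (\<Sum>k. ennreal (pmf \<pi> k) * v k)" .
    have "(\<Sum>k. ennreal (pmf \<pi> k) * v k) \<le> (\<Sum>k. ennreal (pmf \<pi> k) * c)"
      unfolding v_def by (intro suminf_mono_ennreal mult_left_mono) auto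
    also have "\<dots> = c" by (simp add: ennreal_suminf_multc pmf_suminf)
    finally have "ennreal (pmf \<pi> i) * w i = ennreal (pmf \<pi> i) * v i"
      using c by (intro suminf_eq_imp_eq_ennreal[OF _ eq] mult_left_mono wv) (auto simp: top_unique)
    then have "w i = v i"
      using pmf_pos[of i] by (simp add: ennreal_mult_cancel_left)
    then have "(\<Sum>l. ennreal (p i l t) * v l) = (\<Sum>l. ennreal (p i l t) * c)"
      using c p_row_ennreal[OF t(1), of i] by (simp add: w_def v_def ennreal_suminf_multc min_absorb2)
    then have "ennreal (p i j t) * v j = ennreal (p i j t) * c"
      using c p_row_ennreal[OF t(1), of i]
      by (intro suminf_eq_imp_eq_ennreal[where a="\<lambda>l. ennreal (p i l t) * v l"] mult_left_mono)
        (auto simp: v_def ennreal_suminf_multc)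
    then have "v j = c" using t by (simp add: ennreal_mult_cancel_left)
    then show ?thesis by (simp add: v_def min_def split: if_splits)
  qed
  \<comment> \<open>A level strictly below \<open>u i\<close> is finite even when \<open>u i\<close>
    is infinite, so truncation handles infinite values too.\<close>
  have "u i \<le> u j" for i j
  proof (rule ccontr)
    assume "\<not> u i \<le> u j"
    then obtain c where "u j < c" "c < u i" by (metis dense not_le)
    then show False using trunc[of c i j] top.extremum_strict[of "u i"] by (metis less_imp_le not_le)
  qed
  then show ?thesis by (intro antisym)
qed

text \<open>\<open>beta_reversible\<close> turns the mean of \<open>pmf \<pi> k / beta k\<close>
  under \<open>p i k t\<close> into the stationarity equation at \<open>i\<close> divided by
  \<open>beta i\<close>. The quotient is therefore superharmonic, hence constant.\<close>

lemma reversible: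
  assumes "0 \<le> t"
  shows "pmf \<pi> i * p i j t = pmf \<pi> j * p j i t"
proof -
  define u where "u = (\<lambda>k. ennreal (pmf \<pi> k / beta k))"
  have "(\<Sum>k. ennreal (p i k t) * u k) \<le> u i" if "0 \<le> t" for t i
  proof -
    have "p i k t * (pmf \<pi> k / beta k) = pmf \<pi> k * p k i t / beta i" for k
      using beta_reversible[OF that, of i k] beta_pos[of i] beta_pos[of k]
      by (simp add: field_simps)
    then have "(\<Sum>k. ennreal (p i k t) * u k) = (\<Sum>k. ennreal (pmf \<pi> k * p k i t / beta i))"
      by (simp add: u_def ennreal_mult'[symmetric])
    also have "\<dots> = u i"
      unfolding u_def
      by (rule suminf_ennreal_sums, use beta_pos[of i] in simp, rule sums_divide)
        (use stationary that in \<open>auto simp: stationary_distribution_def\<close>)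
    finally show ?thesis by simp
  qed
  then have "u i = u j" by (rule superharmonic_const)
  then have "pmf \<pi> i / beta i = pmf \<pi> j / beta j"
    using beta_pos[of i] beta_pos[of j] by (simp add: u_def)
  then have "pmf \<pi> i = pmf \<pi> j / beta j * beta i"
    using beta_pos[of i] by (simp add: divide_eq_eq)
  then have "pmf \<pi> i * p i j t = pmf \<pi> j / beta j * (beta i * p i j t)" by simp
  then show ?thesis
    unfolding beta_reversible[OF assms, of i j] using beta_pos[of j] by simp
qed

section \<open>Monotonicity and continuity of the return probabilities\<close>

text \<open>Chapman-Kolmogorov at the midpoint and reversibility: the right side is the squared norm
  in L2(\<pi>) of the half-time transition operator applied to the indicator of
  \<open>j\<close>.\<close>

lemma diag_eq_sum_squares:
  assumes "0 \<le> t"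
  shows "ennreal (pmf \<pi> j * p j j t) = (\<Sum>k. ennreal (pmf \<pi> k) * (ennreal (p k j (t / 2)))\<^sup>2)"
proof -
  have "ennreal (pmf \<pi> j * p j j t) = (\<Sum>k. ennreal (pmf \<pi> j) * (ennreal (p j k (t / 2)) * ennreal (p k j (t / 2))))"
    using chapman_kolmogorov_ennreal[of "t / 2" "t / 2" j j] assms
    by (simp add: ennreal_mult'[OF pmf_nonneg])
  also have "\<dots> = (\<Sum>k. ennreal (pmf \<pi> k) * (ennreal (p k j (t / 2)))\<^sup>2)"
  proof (rule suminf_cong)
    fix k
    show "ennreal (pmf \<pi> j) * (ennreal (p j k (t / 2)) * ennreal (p k j (t / 2))) =
        ennreal (pmf \<pi> k) * (ennreal (p k j (t / 2)))\<^sup>2"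
      unfolding power2_eq_square mult.assoc[symmetric] ennreal_mult'[OF pmf_nonneg, symmetric]
      using reversible[of "t / 2" j k] assms by simp
  qed
  finally show ?thesis .
qed

text \<open>Jensen's inequality for \<open>p k j (t / 2)\<close> as a function of \<open>k\<close>,
  whose \<pi>-mean is \<open>pmf \<pi> j\<close>.\<close>

lemma pmf_le_diag:
  assumes "0 \<le> t" shows "pmf \<pi> j \<le> p j j t"
proof -
  have "ennreal (pmf \<pi> j * pmf \<pi> j) = (\<Sum>k. ennreal (pmf \<pi> k) * ennreal (p k j (t / 2)))\<^sup>2"
    using assms by (simp add: stationary_suminf power2_eq_square ennreal_mult')
  also have "\<dots> \<le> ennreal (pmf \<pi> j * p j j t)"
    unfolding diag_eq_sum_squares[OF assms] by (rule suminf_square_le_ennreal) (auto simp: pmf_suminf)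
  finally show ?thesis using pmf_pos[of j] by (simp add: ennreal_le_iff mult_le_cancel_left_pos)
qed

text \<open>The transition operator over the extra half-time \<open>(t - s) / 2\<close> contracts
  L2(\<pi>): Jensen's inequality in each row, then stationarity.\<close>

lemma diag_antimono:
  assumes "0 \<le> s" "s \<le> t" shows "p j j t \<le> p j j s"
proof -
  let ?h = "(t - s) / 2"
  have "ennreal (pmf \<pi> j * p j j t) =
      (\<Sum>i. ennreal (pmf \<pi> i) * (\<Sum>k. ennreal (p i k ?h) * ennreal (p k j (s / 2)))\<^sup>2)"
    using assms diag_eq_sum_squares[of t j] chapman_kolmogorov_ennreal[of ?h "s / 2" _ j]
    by (simp add: add_divide_distrib[symmetric])
  also have "\<dots> \<le> (\<Sum>i. ennreal (pmf \<pi> i) * (\<Sum>k. ennreal (p i k ?h) * (ennreal (p k j (s / 2)))\<^sup>2))"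
    using assms by (intro suminf_mono_ennreal mult_left_mono suminf_square_le_ennreal p_row_ennreal) auto
  also have "\<dots> = (\<Sum>k. \<Sum>i. ennreal (pmf \<pi> i) * ennreal (p i k ?h) * (ennreal (p k j (s / 2)))\<^sup>2)"
    unfolding ennreal_suminf_cmult[symmetric] by (subst suminf_swap_ennreal) (simp add: mult.assoc)
  also have "\<dots> = (\<Sum>k. ennreal (pmf \<pi> k) * (ennreal (p k j (s / 2)))\<^sup>2)"
    using assms by (simp add: ennreal_suminf_multc stationary_suminf)
  also have "\<dots> = ennreal (pmf \<pi> j * p j j s)"
    using assms by (simp add: diag_eq_sum_squares)
  finally show ?thesis using pmf_pos[of j] by (simp add: ennreal_le_iff mult_le_cancel_left_pos)
qed

lemma diag_tendsto_1: "(p j j \<longlongrightarrow> 1) (at_right 0)"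
proof -
  have "((\<lambda>h. 1 - h * ((1 - p j j h) / h)) \<longlongrightarrow> 1 - 0 * (lam j + (if j = 0 then 0 else mu j))) (at_right 0)"
    by (intro tendsto_intros exit_rate)
  moreover have "\<forall>\<^sub>F h in at_right 0. 1 - h * ((1 - p j j h) / h) = p j j h"
    unfolding eventually_at_right_field by (intro exI[of _ 1]) auto
  ultimately show ?thesis by (simp add: Lim_transform_eventually)
qed

text \<open>Between \<open>a\<close> and \<open>b\<close> the decreasing function
  \<open>p j j\<close> drops by at most \<open>1 - p j j (b - a)\<close>, since staying in
  \<open>j\<close> can be split by \<open>p_prod_le\<close>. This is small uniformly in
  \<open>a\<close>.\<close>

lemma diag_continuous: "continuous_on {0..} (p j j)"
  unfolding continuous_on_iff
proof (intro ballI allI impI)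
  fix t \<epsilon> :: real assume t: "t \<in> {0..}" and \<epsilon>: "0 < \<epsilon>"
  have "\<forall>\<^sub>F h in at_right 0. 1 - \<epsilon> < p j j h"
    using order_tendstoD(1)[OF diag_tendsto_1[of j], of "1 - \<epsilon>"] \<epsilon> by simp
  then obtain d where d: "0 < d" "\<And>h. 0 < h \<Longrightarrow> h < d \<Longrightarrow> 1 - \<epsilon> < p j j h"
    unfolding eventually_at_right_field by auto
  have close: "dist (p j j b) (p j j a) < \<epsilon>" if "0 \<le> a" "a \<le> b" "b - a < d" for a b
  proof (cases "a = b")
    case False
    then have "p j j a - p j j b \<le> p j j a * (1 - p j j (b - a))"
      using p_prod_le[of "a" "b - a" j j j] that by (simp add: algebra_simps)
    also have "\<dots> \<le> 1 * (1 - p j j (b - a))" by (intro mult_right_mono) auto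
    also have "\<dots> < \<epsilon>" using d(2)[of "b - a"] that False by simp
    finally show ?thesis using diag_antimono[of a b j] that by (simp add: dist_real_def)
  qed (use \<epsilon> in simp)
  show "\<exists>d>0. \<forall>s\<in>{0..}. dist s t < d \<longrightarrow> dist (p j j s) (p j j t) < \<epsilon>"
  proof (intro exI[of _ d] conjI d(1) ballI impI)
    fix s assume "s \<in> {0..}" "dist s t < d"
    then show "dist (p j j s) (p j j t) < \<epsilon>"
      using close[of s t] close[of t s] t by (cases "s \<le> t") (auto simp: dist_commute dist_real_def)
  qed
qed

text \<open>Decreasing and bounded below by \<open>pmf \<pi> j\<close>. That the limit equals this
  bound needs hitting times and is shown in \<open>diag_tendsto_pmf\<close>.\<close>

lemma diag_converges: "\<exists>L\<ge>pmf \<pi> j. (p j j \<longlongrightarrow> L) at_top"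
proof -
  define L where "L = (INF t\<in>{0..}. p j j t)"
  have bdd: "bdd_below (p j j ` {0..})" by (rule bdd_belowI[of _ 0]) auto
  have "(p j j \<longlongrightarrow> L) at_top"
  proof (rule decreasing_tendsto)
    show "\<forall>\<^sub>F t in at_top. L \<le> p j j t"
      using eventually_ge_at_top[of 0] by eventually_elim (auto simp: L_def intro!: cINF_lower bdd)
    fix x assume "L < x"
    then obtain s where s: "0 \<le> s" "p j j s < x"
      unfolding L_def using cINF_less_iff[OF _ bdd] by auto
    show "\<forall>\<^sub>F t in at_top. p j j t < x"
      using eventually_ge_at_top[of s]
      by eventually_elim (rule le_less_trans[OF diag_antimono[OF s(1)] s(2)])
  qed
  moreover have "pmf \<pi> j \<le> L" unfolding L_def by (rule cINF_greatest) (auto simp: pmf_le_diag)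
  ultimately show ?thesis by blast
qed

end

subsection \<open>First passage\<close>

context markov_jump_process
begin

lemma right_constant:
  assumes "\<omega> \<in> space M" "0 \<le> t"
  obtains b where "t < b" "\<And>s. t \<le> s \<Longrightarrow> s < b \<Longrightarrow> X s \<omega> = X t \<omega>"
proof -
  obtain b where "t < b" "\<And>s. t < s \<Longrightarrow> s < b \<Longrightarrow> X s \<omega> = X t \<omega>"
    using right_continuous_paths[OF assms] by (auto simp: eventually_at_right_field)
  then show thesis by (intro that[of b]) (auto simp: le_less)
qed

text \<open>By right-continuity the infimum is attained: visits to \<open>j\<close> occur
  arbitrarily soon after it, within the interval where the path keeps its value.\<close>

lemma hitting_time_cases:
  assumes "\<omega> \<in> space M"
  obtains (never) "hitting_time X j \<omega> = \<top>" "\<And>t. 0 \<le> t \<Longrightarrow> X t \<omega> \<noteq> j"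
  | (hit) r where "0 \<le> r" "hitting_time X j \<omega> = ennreal r" "X r \<omega> = j"
      "\<And>t. 0 \<le> t \<Longrightarrow> t < r \<Longrightarrow> X t \<omega> \<noteq> j"
proof (cases "\<exists>t\<ge>0. X t \<omega> = j")
  case False
  then have "{ennreal t | t. 0 \<le> t \<and> X t \<omega> = j} = {}" by auto
  then have "hitting_time X j \<omega> = \<top>" by (simp only: hitting_time_def Inf_empty)
  with False show thesis by (intro never) auto
next
  case True
  define A where "A = {t. 0 \<le> t \<and> X t \<omega> = j}"
  define r where "r = Inf A"
  have A: "A \<noteq> {}" "bdd_below A" using True by (auto simp: A_def intro: bdd_belowI[of _ 0])
  have r: "0 \<le> r" unfolding r_def by (rule cInf_greatest[OF A(1)]) (auto simp: A_def)
  obtain b where b: "r < b" "\<And>s. r \<le> s \<Longrightarrow> s < b \<Longrightarrow> X s \<omega> = X r \<omega>"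
    using right_constant[OF assms r] by blast
  obtain t where t: "t \<in> A" "t < b" using b(1) cInf_less_iff[OF A] by (auto simp: r_def)
  have "r \<le> t" unfolding r_def by (rule cInf_lower[OF t(1) A(2)])
  then have Xr: "X r \<omega> = j" using b(2)[of t] t by (auto simp: A_def)
  have before: "X t \<omega> \<noteq> j" if "0 \<le> t" "t < r" for t
    using that cInf_lower[OF _ A(2), of t] by (auto simp: A_def r_def)
  have "hitting_time X j \<omega> = ennreal r"
    unfolding hitting_time_def
  proof (rule antisym)
    show "Inf {ennreal t |t. 0 \<le> t \<and> X t \<omega> = j} \<le> ennreal r" using r Xr by (intro Inf_lower) auto
    show "ennreal r \<le> Inf {ennreal t |t. 0 \<le> t \<and> X t \<omega> = j}"
    proof (rule Inf_greatest)
      fix x assume "x \<in> {ennreal t |t. 0 \<le> t \<and> X t \<omega> = j}"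
      then obtain t where t: "x = ennreal t" "0 \<le> t" "X t \<omega> = j" by blast
      then have "r \<le> t" using before[of t] by (cases "t < r") auto
      then show "ennreal r \<le> x" using t by (simp add: ennreal_leI)
    qed
  qed
  then show thesis using r Xr before by (intro hit)
qed

text \<open>After the hit the path stays in \<open>j\<close> for a while, so a hit before
  \<open>y\<close> is witnessed by a rational time before \<open>y\<close>.\<close>

lemma measurable_hitting_time [measurable]: "hitting_time X j \<in> borel_measurable (P i)"
proof (rule borel_measurableI_less)
  fix y :: ennreal
  have eq: "{\<omega> \<in> space (P i). hitting_time X j \<omega> < y} =
    (\<Union>q\<in>{q\<in>\<rat>. 0 \<le> q \<and> ennreal q < y}. {\<omega> \<in> space (P i). X q \<omega> = j})" (is "?A = ?B")
  proof (intro set_eqI iffI)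
    fix \<omega> assume "\<omega> \<in> ?B"
    then obtain q where q: "0 \<le> q" "ennreal q < y" "\<omega> \<in> space (P i)" "X q \<omega> = j" by blast
    have "hitting_time X j \<omega> \<le> ennreal q"
      unfolding hitting_time_def using q by (intro Inf_lower) auto
    then show "\<omega> \<in> ?A" using q by auto
  next
    fix \<omega> assume \<omega>: "\<omega> \<in> ?A"
    then have "\<omega> \<in> space M" using space_P by auto
    then show "\<omega> \<in> ?B"
    proof (cases rule: hitting_time_cases[where j=j])
      case never then show ?thesis using \<omega> by auto
    next
      case (hit r)
      obtain b where b: "r < b" "\<And>s. r \<le> s \<Longrightarrow> s < b \<Longrightarrow> X s \<omega> = X r \<omega>"
        using right_constant[OF \<open>\<omega> \<in> space M\<close> hit(1)] by blast
      obtain c where c: "ennreal r < c" "c < y" using \<omega> hit(2) dense by auto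
      then obtain z where z: "c = ennreal z" "0 \<le> z" by (cases c) auto
      then have "r < z" using c(1) hit(1) by (simp add: ennreal_less_iff)
      then obtain q where q: "q \<in> \<rat>" "r < q" "q < min b z"
        using Rats_dense_in_real[of r "min b z"] b(1) by auto
      have "ennreal q < y" using q z c by (auto intro: le_less_trans[OF ennreal_leI[of q z]])
      moreover have "X q \<omega> = j" using b(2)[of q] q hit by auto
      ultimately show ?thesis using q hit \<omega> by (auto intro!: bexI[of _ q])
    qed
  qed
  have "countable {q\<in>\<rat>. 0 \<le> q \<and> ennreal q < y}"
    by (rule countable_subset[OF _ countable_rat]) auto
  then show "?A \<in> sets (P i)"
    unfolding eq by (intro sets.countable_UN'') (auto intro!: predE pred_X_eq)
qed

text \<open>\<open>R n k\<close> puts the time in cell \<open>k\<close> of the grid with mesh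
  \<open>1 / (n + 1)\<close> and reads the path at the right end of the cell. That end lies to the
  right of the time, so by right-continuity the reading is correct for all large
  \<open>n\<close>.\<close>

lemma pred_X_joint: "Measurable.pred (lborel \<Otimes>\<^sub>M P i) (\<lambda>z. 0 \<le> fst z \<and> X (fst z) (snd z) = j)"
proof -
  define R where "R = (\<lambda>(n::nat) (k::nat) (z :: real \<times> 'w). real k \<le> fst z * (real n + 1) \<and>
    fst z * (real n + 1) < real k + 1 \<and> X ((real k + 1) / (real n + 1)) (snd z) = j)"
  have [measurable]: "Measurable.pred (P i) (\<lambda>\<omega>. X ((real k + 1) / (real n + 1)) \<omega> = j)" for k n :: nat
    by (rule pred_X_eq) simp
  have R: "Measurable.pred (lborel \<Otimes>\<^sub>M P i) (R n k)" for n k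
    unfolding R_def by measurable
  have "Measurable.pred (lborel \<Otimes>\<^sub>M P i) (\<lambda>z. 0 \<le> fst z \<and> (\<exists>N. \<forall>n. N \<le> n \<longrightarrow> (\<exists>k. R n k z)))"
    by (intro pred_intros_logic pred_intros_countable R) measurable
  moreover have "(0 \<le> fst z \<and> (\<exists>N. \<forall>n. N \<le> n \<longrightarrow> (\<exists>k. R n k z))) \<longleftrightarrow> (0 \<le> fst z \<and> X (fst z) (snd z) = j)"
    if "z \<in> space (lborel \<Otimes>\<^sub>M P i)" for z
  proof -
    obtain u \<omega> where z: "z = (u, \<omega>)" by (cases z)
    have \<omega>: "\<omega> \<in> space M" using that by (simp add: z space_pair_measure space_P)
    have "(\<exists>N. \<forall>n. N \<le> n \<longrightarrow> (\<exists>k. R n k z)) \<longleftrightarrow> X u \<omega> = j" if u: "0 \<le> u"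
    proof -
      obtain b where b: "u < b" "\<And>s. u \<le> s \<Longrightarrow> s < b \<Longrightarrow> X s \<omega> = X u \<omega>"
        using right_constant[OF \<omega> u] by blast
      \<comment> \<open>Meshes below \<open>b - u\<close> keep the right end of the cell inside the
        interval of constancy.\<close>
      obtain N where N: "inverse (real (Suc N)) < b - u" using reals_Archimedean[of "b - u"] b(1) by auto
      have iff: "(\<exists>k. R n k z) \<longleftrightarrow> X u \<omega> = j" if "N \<le> n" for n
      proof -
        define k where "k = nat \<lfloor>u * (real n + 1)\<rfloor>"
        have k: "real k \<le> u * (real n + 1)" "u * (real n + 1) < real k + 1"
          using u by (auto simp: k_def)
        have uniq: "l = k" if "real l \<le> u * (real n + 1)" "u * (real n + 1) < real l + 1" for l
          using that k by linarith
        have "inverse (real (Suc n)) \<le> inverse (real (Suc N))" using \<open>N \<le> n\<close> by simp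
        then have "1 / (real n + 1) < b - u" using N by (simp add: inverse_eq_divide add.commute)
        moreover have "(real k + 1) / (real n + 1) \<le> u + 1 / (real n + 1)"
          using k(1) by (simp add: add_divide_distrib pos_divide_le_eq)
        moreover have "u \<le> (real k + 1) / (real n + 1)" using k by (simp add: field_simps)
        ultimately have eq: "X ((real k + 1) / (real n + 1)) \<omega> = X u \<omega>" by (intro b(2)) auto
        show ?thesis
        proof
          assume "\<exists>k. R n k z"
          then obtain l where l: "R n l z" ..
          then have "l = k" by (intro uniq) (simp_all add: R_def z)
          then show "X u \<omega> = j" using l eq by (simp add: R_def z)
        next
          assume "X u \<omega> = j"
          then have "R n k z" using k eq by (simp add: R_def z)
          then show "\<exists>k. R n k z" ..
        qed
      qed
      show ?thesis
      proof
        assume "\<exists>N. \<forall>n. N \<le> n \<longrightarrow> (\<exists>k. R n k z)"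
        then obtain N' where "\<And>n. N' \<le> n \<Longrightarrow> \<exists>k. R n k z" by blast
        then show "X u \<omega> = j" using iff[of "max N N'"] by auto
      next
        assume "X u \<omega> = j" then show "\<exists>N. \<forall>n. N \<le> n \<longrightarrow> (\<exists>k. R n k z)" using iff by blast
      qed
    qed
    then show ?thesis by (auto simp: z)
  qed
  ultimately show ?thesis by (simp cong: measurable_cong)
qed

lemma nn_integral_sojourn_time:
  "(\<integral>\<^sup>+\<omega>. sojourn_time X j t \<omega> \<partial>P i) = (\<integral>\<^sup>+u. ennreal (p i j u) * indicator {0..t} u \<partial>lborel)"
proof -
  interpret prob_space "P i" by (rule prob_space_P)
  interpret pair_sigma_finite lborel "P i" ..
  define f where "f = (\<lambda>z. indicator {z \<in> space (lborel \<Otimes>\<^sub>M P i). 0 \<le> fst z \<and> X (fst z) (snd z) = j} z * (indicator {0..t} (fst z) :: ennreal))"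
  have [measurable]: "{z \<in> space (lborel \<Otimes>\<^sub>M P i). 0 \<le> fst z \<and> X (fst z) (snd z) = j} \<in> sets (lborel \<Otimes>\<^sub>M P i)"
    by (intro predE pred_X_joint)
  have [measurable]: "f \<in> borel_measurable (lborel \<Otimes>\<^sub>M P i)"
    unfolding f_def by measurable
  have "(\<integral>\<^sup>+\<omega>. sojourn_time X j t \<omega> \<partial>P i) = (\<integral>\<^sup>+\<omega>. \<integral>\<^sup>+u. f (u, \<omega>) \<partial>lborel \<partial>P i)"
    unfolding sojourn_time_def f_def
    by (intro nn_integral_cong) (auto simp: indicator_def space_pair_measure)
  also have "\<dots> = (\<integral>\<^sup>+u. \<integral>\<^sup>+\<omega>. f (u, \<omega>) \<partial>P i \<partial>lborel)"
    by (rule Fubini) measurable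
  also have "\<dots> = (\<integral>\<^sup>+u. ennreal (p i j u) * indicator {0..t} u \<partial>lborel)"
  proof (intro nn_integral_cong)
    fix u :: real
    show "(\<integral>\<^sup>+\<omega>. f (u, \<omega>) \<partial>P i) = ennreal (p i j u) * indicator {0..t} u"
    proof (cases "u \<in> {0..t}")
      case True
      then have "(\<integral>\<^sup>+\<omega>. f (u, \<omega>) \<partial>P i) = (\<integral>\<^sup>+\<omega>. indicator {\<omega> \<in> space (P i). X u \<omega> = j} \<omega> \<partial>P i)"
        by (intro nn_integral_cong) (auto simp: f_def indicator_def space_pair_measure)
      also have "\<dots> = ennreal (p i j u)"
        using True by (subst nn_integral_indicator)
          (auto simp: trans_prob_def emeasure_eq_measure intro!: predE pred_X_eq)
      finally show ?thesis using True by simp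
    qed (simp add: f_def)
  qed
  finally show ?thesis .
qed

end

section \<open>First-passage decomposition\<close>

context stationary_birth_death_process
begin

text \<open>The extension by 0 to negative times makes a delayed start contribute nothing before it
  happens.\<close>

definition diag :: "nat \<Rightarrow> real \<Rightarrow> ennreal" where "diag j x = (if 0 \<le> x then ennreal (p j j x) else 0)"

lemma borel_measurable_diag [measurable]: "diag j \<in> borel_measurable borel"
proof -
  have "(\<lambda>x. p j j x * indicator {0..} x) \<in> borel_measurable borel"
    using borel_measurable_continuous_on_indicator[OF _ diag_continuous[of j]]
    by (simp add: mult.commute)
  then have "(\<lambda>x. ennreal (p j j x * indicator {0..} x)) \<in> borel_measurable borel" by measurable
  moreover have "diag j = (\<lambda>x. ennreal (p j j x * indicator {0..} x))"
    by (auto simp: diag_def indicator_def)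
  ultimately show ?thesis by simp
qed

lemma diag_le_1: "diag j x \<le> 1" by (simp add: diag_def)

text \<open>The probability of being in \<open>j\<close> at time \<open>u\<close> for a process that starts in \<open>j\<close> at time \<open>\<theta>\<close>.\<close>

definition shifted_diag :: "nat \<Rightarrow> ennreal \<Rightarrow> real \<Rightarrow> ennreal" where
  "shifted_diag j \<theta> u = (if \<theta> = \<top> then 0 else diag j (u - enn2real \<theta>))"

lemma borel_measurable_shifted_diag [measurable (raw)]:
  assumes [measurable]: "f \<in> borel_measurable N" "g \<in> borel_measurable N"
  shows "(\<lambda>x. shifted_diag j (f x) (g x)) \<in> borel_measurable N"
  unfolding shifted_diag_def by measurable

lemma shifted_diag_le_1: "shifted_diag j \<theta> u \<le> 1" by (simp add: shifted_diag_def diag_le_1)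

text \<open>The first visit to \<open>j\<close> along the dyadic grid comes after the hitting time
  and, for a fine mesh, at most one mesh width later; continuity of \<open>p j j\<close> then gives
  the limit. If \<open>j\<close> is not hit by \<open>u\<close>, both sides are 0.\<close>

lemma grid_hit_tendsto:
  assumes \<omega>: "\<omega> \<in> space M" and u: "0 < u"
  defines "h \<equiv> \<lambda>n. u / 2 ^ n"
  shows "(\<lambda>n. if \<exists>k\<le>2^n. X (real k * h n) \<omega> = j
      then ennreal (p j j (u - real (LEAST k. X (real k * h n) \<omega> = j) * h n)) else 0)
    \<longlonglongrightarrow> shifted_diag j (hitting_time X j \<omega>) u"
    (is "?\<phi> \<longlonglongrightarrow> _")
  using \<omega>
proof (cases rule: hitting_time_cases[where j=j])
  case never
  have "?\<phi> n = 0" for n using never(2)[of "real _ * h n"] u by (auto simp: h_def)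
  then show ?thesis using never(1) by (simp add: shifted_diag_def)
next
  case (hit r)
  have h_pos: "0 < h n" for n using u by (simp add: h_def)
  have h_lim: "h \<longlonglongrightarrow> 0"
    using dyadic_step_tendsto[OF u] unfolding h_def by (simp add: filterlim_at)
  have grid_end: "real (2^n) * h n = u" for n by (simp add: h_def)
  show ?thesis
  proof (cases "r \<le> u")
    case False
    have "X (real k * h n) \<omega> \<noteq> j" if "k \<le> 2^n" for k n
    proof (rule hit(4))
      have "real k * h n \<le> real (2^n) * h n" 
        using that h_pos[of n] by (intro mult_right_mono) (auto simp: of_nat_le_iff simp del: of_nat_power)
      then show "real k * h n < r" using False grid_end[of n] by linarith
    qed (use h_pos[of n] in simp)
    then have "\<not> (\<exists>k\<le>2^n. X (real k * h n) \<omega> = j)" for n by blast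
    then have "?\<phi> n = 0" for n by (rule if_not_P)
    then show ?thesis using hit(1,2) False by (simp add: shifted_diag_def diag_def)
  next
    case True
    obtain b where b: "r < b" "\<And>s. r \<le> s \<Longrightarrow> s < b \<Longrightarrow> X s \<omega> = X r \<omega>"
      using right_constant[OF \<omega> hit(1)] by blast
    define K where "K = (\<lambda>n. LEAST k. X (real k * h n) \<omega> = j)"
    have "\<forall>\<^sub>F n in sequentially. h n < b - r"
      using order_tendstoD(2)[OF h_lim, of "b - r"] b(1) by simp
    then have ev: "\<forall>\<^sub>F n in sequentially. ?\<phi> n = ennreal (p j j (u - real (K n) * h n)) \<and>
        r \<le> real (K n) * h n \<and> real (K n) * h n \<le> r + h n \<and> real (K n) * h n \<le> u"
    proof eventually_elim
      case (elim n)
      \<comment> \<open>The first grid index at or after the hit \<open>r\<close>. As the mesh is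
        below \<open>b - r\<close>, the path is still in \<open>j\<close> there, so the least index
        \<open>K n\<close> is at most \<open>k\<close>.\<close>
      define k where "k = nat \<lceil>r / h n\<rceil>"
      have "0 \<le> r / h n" using hit(1) h_pos[of n] by simp
      then have k: "r / h n \<le> real k" "real k < r / h n + 1" by (auto simp: k_def; linarith)+
      then have k': "r \<le> real k * h n" "real k * h n < r + h n"
        using h_pos[of n] by (auto simp: field_simps)
      have Xk: "X (real k * h n) \<omega> = j" using b(2)[OF k'(1)] k'(2) elim hit(3) by simp
      have "r / h n \<le> real (2^n)" using True h_pos[of n] grid_end[of n] by (simp add: field_simps)
      then have k2: "k \<le> 2^n" unfolding k_def by (simp add: ceiling_le_iff nat_le_iff)
      have XK: "X (real (K n) * h n) \<omega> = j" unfolding K_def by (rule LeastI[of _ k]) (rule Xk)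
      have Kk: "K n \<le> k" unfolding K_def by (rule Least_le) (rule Xk)
      then have Kk': "real (K n) * h n \<le> real k * h n" using h_pos[of n] by (intro mult_right_mono) auto
      have "r \<le> real (K n) * h n" using hit(4)[of "real (K n) * h n"] XK h_pos[of n] by (cases "real (K n) * h n < r") auto
      moreover have "real (K n) * h n \<le> real (2^n) * h n"
        using Kk k2 h_pos[of n] by (intro mult_right_mono) (auto simp: of_nat_le_iff simp del: of_nat_power)
      ultimately show ?case using Kk' k'(2) Xk k2 grid_end[of n] by (auto simp: K_def)
    qed
    have "(\<lambda>n. real (K n) * h n) \<longlonglongrightarrow> r"
    proof (rule tendsto_sandwich[OF _ _ tendsto_const])
      show "(\<lambda>n. r + h n) \<longlonglongrightarrow> r" using tendsto_add[OF tendsto_const h_lim, of r] by simp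
    qed (use ev in \<open>auto elim: eventually_mono\<close>)
    then have "(\<lambda>n. u - real (K n) * h n) \<longlonglongrightarrow> u - r" by (intro tendsto_intros)
    then have "(\<lambda>n. p j j (u - real (K n) * h n)) \<longlonglongrightarrow> p j j (u - r)"
      using True ev by (intro continuous_on_tendsto_compose[OF diag_continuous]) (auto elim: eventually_mono)
    then have "(\<lambda>n. ennreal (p j j (u - real (K n) * h n))) \<longlonglongrightarrow> ennreal (p j j (u - r))"
      by (rule tendsto_ennrealI)
    moreover have "shifted_diag j (hitting_time X j \<omega>) u = ennreal (p j j (u - r))"
      using hit(1,2) True by (simp add: shifted_diag_def diag_def)
    moreover have "\<forall>\<^sub>F n in sequentially. ennreal (p j j (u - real (K n) * h n)) = ?\<phi> n"
      by (rule eventually_mono[OF ev]) (erule conjE, erule sym)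
    ultimately show ?thesis by (simp only: Lim_transform_eventually)
  qed
qed

text \<open>The strong Markov property at the hitting time, in the one instance needed. On each grid
  the ordinary Markov property at the first grid visit gives exactly \<open>p i j u\<close>, and
  dominated convergence refines the grid.\<close>

lemma first_passage:
  assumes u: "0 < u"
  shows "ennreal (p i j u) = (\<integral>\<^sup>+\<omega>. shifted_diag j (hitting_time X j \<omega>) u \<partial>P i)"
proof -
  interpret prob_space "P i" by (rule prob_space_P)
  define h where "h = (\<lambda>n. u / 2 ^ n)"
  have h_pos: "0 < h n" for n using u by (simp add: h_def)
  have grid_end: "real (2^n) * h n = u" for n by (simp add: h_def)
  define F where "F = (\<lambda>n k. {\<omega> \<in> space (P i). (\<forall>l<k. X (real l * h n) \<omega> \<in> - {j}) \<and> X (real k * h n) \<omega> = j})"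
  define \<phi> where "\<phi> = (\<lambda>n \<omega>. \<Sum>k\<le>2^n. indicator (F n k) \<omega> * ennreal (p j j (u - real k * h n)))"
  have F_sets: "F n k \<in> sets (P i)" for n k
    unfolding F_def using h_pos[of n]
    by (intro predE pred_intros_logic pred_intros_countable pred_intros_imp' pred_X_eq pred_X_in) auto
  have k_le: "real k * h n \<le> u" if "k \<le> 2^n" for k n
  proof -
    have "real k * h n \<le> real (2^n) * h n"
      using that h_pos[of n] by (intro mult_right_mono) (auto simp: of_nat_le_iff simp del: of_nat_power)
    then show ?thesis using grid_end[of n] by simp
  qed
  have \<phi>_eq: "\<phi> n \<omega> = (if \<exists>k\<le>2^n. X (real k * h n) \<omega> = j
      then ennreal (p j j (u - real (LEAST k. X (real k * h n) \<omega> = j) * h n)) else 0)"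
    if "\<omega> \<in> space (P i)" for n \<omega>
  proof (cases "\<exists>k\<le>2^n. X (real k * h n) \<omega> = j")
    case True
    define K where "K = (LEAST k. X (real k * h n) \<omega> = j)"
    have XK: "X (real K * h n) \<omega> = j" unfolding K_def using True by (metis (mono_tags) LeastI)
    have K: "K \<le> 2^n" unfolding K_def using True by (metis (mono_tags, lifting) Least_le order_trans)
    have "indicator (F n k) \<omega> = (if k = K then 1 else (0::ennreal))" for k
    proof -
      have "\<omega> \<in> F n k \<longleftrightarrow> k = K"
      proof
        assume "\<omega> \<in> F n k"
        then show "k = K" unfolding F_def K_def by (intro Least_equality[symmetric]) (auto simp: not_le[symmetric])
      next
        assume "k = K" then show "\<omega> \<in> F n k"
          using XK that not_less_Least[of _ "\<lambda>k. X (real k * h n) \<omega> = j"] by (auto simp: F_def K_def)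
      qed
      then show ?thesis by (simp add: indicator_def)
    qed
    then have "\<phi> n \<omega> = (\<Sum>k\<le>2^n. if k = K then ennreal (p j j (u - real K * h n)) else 0)"
      unfolding \<phi>_def by (intro sum.cong) auto
    then show ?thesis using True K by (simp add: K_def)
  next
    case False
    then have "\<phi> n \<omega> = 0"
      unfolding \<phi>_def by (intro sum.neutral) (auto simp: F_def)
    then show ?thesis unfolding if_not_P[OF False] .
  qed
  have int_\<phi>: "(\<integral>\<^sup>+\<omega>. \<phi> n \<omega> \<partial>P i) = ennreal (p i j u)" for n
  proof -
    have "(\<integral>\<^sup>+\<omega>. \<phi> n \<omega> \<partial>P i) = (\<Sum>k\<le>2^n. ennreal (measure (P i) (F n k)) * ennreal (p j j (u - real k * h n)))"
      unfolding \<phi>_def using F_sets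
      by (subst nn_integral_sum, measurable)
        (intro sum.cong refl, subst nn_integral_multc, auto simp: emeasure_eq_measure)
    also have "\<dots> = (\<Sum>k\<le>2^n. ennreal (measure (P i) {\<omega> \<in> F n k. X u \<omega> = j}))"
    proof (intro sum.cong refl)
      fix k :: nat assume k: "k \<in> {..2^n}"
      have "{\<omega> \<in> F n k. X u \<omega> = j} = {\<omega> \<in> space (P i). (\<forall>l<k. X (real l * h n) \<omega> \<in> - {j}) \<and>
          X (real k * h n) \<omega> = j \<and> X (real k * h n + (u - real k * h n)) \<omega> = j}"
        by (auto simp: F_def)
      then have "measure (P i) {\<omega> \<in> F n k. X u \<omega> = j} = measure (P i) (F n k) * p j j (u - real k * h n)"
        unfolding F_def
        using markov_sets[of "\<lambda>l. real l * h n" k "u - real k * h n" i "\<lambda>_. - {j}" j j] k_le[of k n] k h_pos[of n]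
        by (simp add: mult_right_mono)
      then show "ennreal (measure (P i) (F n k)) * ennreal (p j j (u - real k * h n)) =
          ennreal (measure (P i) {\<omega> \<in> F n k. X u \<omega> = j})" by (simp add: ennreal_mult')
    qed
    also have "\<dots> = ennreal (\<Sum>k\<le>2^n. measure (P i) {\<omega> \<in> F n k. X u \<omega> = j})"
      by (simp add: sum_ennreal)
    also have "(\<Sum>k\<le>2^n. measure (P i) {\<omega> \<in> F n k. X u \<omega> = j}) =
        measure (P i) (\<Union>k\<in>{..2^n}. {\<omega> \<in> F n k. X u \<omega> = j})"
    proof (rule finite_measure_finite_Union[symmetric])
      show "(\<lambda>k. {\<omega> \<in> F n k. X u \<omega> = j}) ` {..2^n} \<subseteq> sets (P i)"
      proof (rule image_subsetI)
        fix k
        have "{\<omega> \<in> F n k. X u \<omega> = j} = F n k \<inter> {\<omega> \<in> space (P i). X u \<omega> = j}" by (auto simp: F_def)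
        then show "{\<omega> \<in> F n k. X u \<omega> = j} \<in> sets (P i)"
          using F_sets u by (auto intro!: sets.Int predE pred_X_eq)
      qed
      show "disjoint_family_on (\<lambda>k. {\<omega> \<in> F n k. X u \<omega> = j}) {..2^n}"
        unfolding disjoint_family_on_def F_def by (auto) (metis linorder_neqE_nat)
    qed simp
    \<comment> \<open>The time \<open>u\<close> is itself the last grid point, so being in
      \<open>j\<close> at \<open>u\<close> forces a first grid visit.\<close>
    also have "(\<Union>k\<in>{..2^n}. {\<omega> \<in> F n k. X u \<omega> = j}) = {\<omega> \<in> space (P i). X u \<omega> = j}"
    proof (intro set_eqI iffI)
      fix \<omega> assume \<omega>: "\<omega> \<in> {\<omega> \<in> space (P i). X u \<omega> = j}"
      define K where "K = (LEAST k. X (real k * h n) \<omega> = j)"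
      have X_end: "X (real (2^n) * h n) \<omega> = j" using \<omega> grid_end by simp
      have "K \<le> 2^n" unfolding K_def by (rule Least_le) (rule X_end)
      moreover have "X (real K * h n) \<omega> = j" unfolding K_def by (rule LeastI[of _ "2^n"]) (rule X_end)
      ultimately show "\<omega> \<in> (\<Union>k\<in>{..2^n}. {\<omega> \<in> F n k. X u \<omega> = j})"
        using \<omega> not_less_Least[of _ "\<lambda>k. X (real k * h n) \<omega> = j"] by (auto simp: F_def K_def)
    qed (auto simp: F_def)
    finally show ?thesis by (simp add: trans_prob_def)
  qed
  have "(\<lambda>n. \<integral>\<^sup>+\<omega>. \<phi> n \<omega> \<partial>P i) \<longlonglongrightarrow> (\<integral>\<^sup>+\<omega>. shifted_diag j (hitting_time X j \<omega>) u \<partial>P i)"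
  proof (rule nn_integral_dominated_convergence[where w="\<lambda>_. 1"])
    show "\<phi> n \<in> borel_measurable (P i)" for n
      unfolding \<phi>_def using F_sets by measurable
    show "AE \<omega> in P i. \<phi> n \<omega> \<le> 1" for n by (rule AE_I2) (simp add: \<phi>_eq)
    show "AE \<omega> in P i. (\<lambda>n. \<phi> n \<omega>) \<longlonglongrightarrow> shifted_diag j (hitting_time X j \<omega>) u"
    proof (rule AE_I2)
      fix \<omega> assume \<omega>: "\<omega> \<in> space (P i)"
      then have "\<omega> \<in> space M" by (simp only: space_P)
      from grid_hit_tendsto[OF this u]
      show "(\<lambda>n. \<phi> n \<omega>) \<longlonglongrightarrow> shifted_diag j (hitting_time X j \<omega>) u"
        unfolding \<phi>_eq[OF \<omega>] h_def .
    qed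
  qed (auto simp: emeasure_space_1)
  then show ?thesis by (simp add: int_\<phi> LIMSEQ_const_iff)
qed

end

subsection \<open>Occupation times\<close>

text \<open>Turns a lower bound from Fatou's lemma and a termwise upper bound into a limit, which
  may be infinite.\<close>

lemma tendsto_if_le_liminf:
  fixes a :: "nat \<Rightarrow> ennreal"
  assumes "c \<le> liminf a" "\<And>n. a n \<le> c"
  shows "a \<longlonglongrightarrow> c"
proof -
  have "limsup a \<le> c" by (rule Limsup_bounded) (simp add: assms(2))
  moreover have "liminf a \<le> limsup a" by (rule Liminf_le_Limsup) simp
  ultimately have "liminf a = c" "limsup a = c" using assms(1) by auto
  then show ?thesis by (simp add: tendsto_iff_Liminf_eq_Limsup)
qed

lemma suminf_liminf_le:
  fixes f :: "nat \<Rightarrow> nat \<Rightarrow> ennreal"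
  assumes "\<And>k. (\<lambda>n. f n k) \<longlonglongrightarrow> l k"
  shows "(\<Sum>k. l k) \<le> liminf (\<lambda>n. \<Sum>k. f n k)"
proof -
  have "liminf (\<lambda>n. f n k) = l k" for k using assms[of k] by (intro lim_imp_Liminf) auto
  then show ?thesis
    using nn_integral_liminf[of f "count_space UNIV"] by (simp add: nn_integral_count_space_nat)
qed

text \<open>Fatou's lemma for series; it carries Chapman-Kolmogorov and stationarity to a limit as
  inequalities.\<close>

lemma suminf_le_of_tendsto:
  fixes f :: "nat \<Rightarrow> nat \<Rightarrow> ennreal"
  assumes "\<And>k. (\<lambda>n. f n k) \<longlonglongrightarrow> l k" "\<And>n. (\<Sum>k. f n k) \<le> b n" "b \<longlonglongrightarrow> c"
  shows "(\<Sum>k. l k) \<le> c"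
proof -
  have "(\<Sum>k. l k) \<le> liminf (\<lambda>n. \<Sum>k. f n k)" by (rule suminf_liminf_le[OF assms(1)])
  also have "\<dots> \<le> liminf b" by (intro Liminf_mono always_eventually allI assms(2))
  also have "\<dots> = c" using assms(3) by (intro lim_imp_Liminf) auto
  finally show ?thesis .
qed

section \<open>Certain hitting and the limit of the return probabilities\<close>

context stationary_birth_death_process
begin

lemma diag_seq_tendsto:
  assumes "(p j j \<longlongrightarrow> L) at_top" "filterlim x at_top sequentially"
  shows "(\<lambda>n. diag j (x n)) \<longlonglongrightarrow> ennreal L"
proof -
  have "(\<lambda>n. ennreal (p j j (x n))) \<longlonglongrightarrow> ennreal L"
    using filterlim_compose[OF assms] by (rule tendsto_ennrealI)
  moreover have "\<forall>\<^sub>F n in sequentially. 0 \<le> x n" using assms(2) by (auto simp: filterlim_at_top)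
  then have "\<forall>\<^sub>F n in sequentially. ennreal (p j j (x n)) = diag j (x n)"
    by eventually_elim (simp add: diag_def)
  ultimately show ?thesis by (rule Lim_transform_eventually)
qed

text \<open>Dominated convergence in \<open>first_passage\<close>: the integrand tends to
  \<open>L\<close> where \<open>j\<close> is hit and is 0 elsewhere.\<close>

lemma transition_tendsto:
  assumes L: "(p j j \<longlongrightarrow> L) at_top" and x: "filterlim x at_top sequentially" "\<And>n. 0 < x n"
  shows "(\<lambda>n. ennreal (p i j (x n))) \<longlonglongrightarrow> ennreal L * emeasure (P i) {\<omega> \<in> space (P i). hitting_time X j \<omega> \<noteq> \<top>}"
proof -
  interpret prob_space "P i" by (rule prob_space_P)
  let ?A = "{\<omega> \<in> space (P i). hitting_time X j \<omega> \<noteq> \<top>}"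
  have [measurable]: "?A \<in> sets (P i)" by measurable
  have "(\<lambda>n. \<integral>\<^sup>+\<omega>. shifted_diag j (hitting_time X j \<omega>) (x n) \<partial>P i) \<longlonglongrightarrow> (\<integral>\<^sup>+\<omega>. ennreal L * indicator ?A \<omega> \<partial>P i)"
  proof (rule nn_integral_dominated_convergence[where w="\<lambda>_. 1"])
    show "AE \<omega> in P i. (\<lambda>n. shifted_diag j (hitting_time X j \<omega>) (x n)) \<longlonglongrightarrow> ennreal L * indicator ?A \<omega>"
    proof (rule AE_I2)
      fix \<omega> assume "\<omega> \<in> space (P i)"
      moreover have "filterlim (\<lambda>n. x n - c) at_top sequentially" for c
        using filterlim_tendsto_add_at_top[OF tendsto_const[of "-c"] x(1)] by simp
      ultimately show "(\<lambda>n. shifted_diag j (hitting_time X j \<omega>) (x n)) \<longlonglongrightarrow> ennreal L * indicator ?A \<omega>"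
        using diag_seq_tendsto[OF L] by (cases "hitting_time X j \<omega> = \<top>") (auto simp: shifted_diag_def)
    qed
  qed (auto simp: emeasure_space_1 shifted_diag_le_1)
  moreover have "(\<integral>\<^sup>+\<omega>. ennreal L * indicator ?A \<omega> \<partial>P i) = ennreal L * emeasure (P i) ?A"
    by (rule nn_integral_cmult_indicator) measurable
  ultimately show ?thesis by (simp add: first_passage[OF x(2)])
qed

lemma hitting_time_self: "AE \<omega> in P j. hitting_time X j \<omega> = 0"
  using start[of j]
proof eventually_elim
  case (elim \<omega>)
  then have "hitting_time X j \<omega> \<le> ennreal 0" unfolding hitting_time_def by (intro Inf_lower) (auto intro!: exI[of _ 0])
  then show ?case by simp
qed

text \<open>With \<open>L\<close> the limit of \<open>p j j\<close>, \<open>L\<close> times the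
  probability of hitting \<open>j\<close> from \<open>i\<close> is the limit of
  \<open>p i j\<close>. Fatou's lemma makes it superharmonic, hence constant in \<open>i\<close>,
  and the probability is 1 at \<open>i = j\<close>.\<close>

lemma AE_hitting_time_finite: "AE \<omega> in P i. hitting_time X j \<omega> \<noteq> \<top>"
  and diag_tendsto_pmf: "(p j j \<longlongrightarrow> pmf \<pi> j) at_top"
proof -
  obtain L where L: "pmf \<pi> j \<le> L" "(p j j \<longlongrightarrow> L) at_top" using diag_converges by blast
  have L_pos: "0 < L" using L(1) pmf_pos[of j] by simp
  define f where "f = (\<lambda>i. emeasure (P i) {\<omega> \<in> space (P i). hitting_time X j \<omega> \<noteq> \<top>})"
  \<comment> \<open>\<open>Suc n\<close> keeps the times positive, as \<open>first_passage\<close>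
    requires; the offset \<open>c\<close> is the Chapman-Kolmogorov step.\<close>
  have seq: "filterlim (\<lambda>n. c + real (Suc n)) at_top sequentially" for c
    by (intro filterlim_tendsto_add_at_top[OF tendsto_const]
        filterlim_compose[OF filterlim_real_sequentially filterlim_Suc])
  have lim: "(\<lambda>n. ennreal (p i j (c + real (Suc n)))) \<longlonglongrightarrow> ennreal L * f i" if "0 \<le> c" for i c
    unfolding f_def using that by (intro transition_tendsto[OF L(2) seq]) auto
  have const: "ennreal L * f i = ennreal L * f j" for i
  proof (rule superharmonic_const)
    fix s :: real and i assume s: "0 \<le> s"
    show "(\<Sum>k. ennreal (p i k s) * (ennreal L * f k)) \<le> ennreal L * f i"
    proof (rule suminf_le_of_tendsto)
      show "(\<lambda>n. ennreal (p i k s) * ennreal (p k j (0 + real (Suc n)))) \<longlonglongrightarrow> ennreal (p i k s) * (ennreal L * f k)" for k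
        by (rule ennreal_tendsto_cmult[OF _ lim]) auto
      show "(\<Sum>k. ennreal (p i k s) * ennreal (p k j (0 + real (Suc n)))) \<le> ennreal (p i j (s + real (Suc n)))" for n
        using chapman_kolmogorov_ennreal[of s "real (Suc n)" i j] s by simp
    qed (rule lim[OF s])
  qed
  have "f j = 1"
  proof -
    interpret prob_space "P j" by (rule prob_space_P)
    have "AE \<omega> in P j. \<omega> \<in> {\<omega> \<in> space (P j). hitting_time X j \<omega> \<noteq> \<top>}"
      using hitting_time_self[of j] AE_space by eventually_elim auto
    then show ?thesis
      by (subst (asm) AE_in_set_eq_1) (auto simp: f_def emeasure_eq_measure)
  qed
  then have f: "f i = 1" for i
    using const[of i] L_pos ennreal_mult_cancel_left[of "ennreal L" "f i" 1] by simp
  show "AE \<omega> in P i. hitting_time X j \<omega> \<noteq> \<top>"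
  proof -
    interpret prob_space "P i" by (rule prob_space_P)
    have "AE \<omega> in P i. \<omega> \<in> {\<omega> \<in> space (P i). hitting_time X j \<omega> \<noteq> \<top>}"
      using f[of i] by (subst AE_in_set_eq_1) (auto simp: f_def emeasure_eq_measure)
    then show ?thesis by eventually_elim auto
  qed
  \<comment> \<open>Fatou's lemma in the stationarity equation gives the missing bound
    \<open>L \<le> pmf \<pi> j\<close>.\<close>
  have "(\<Sum>i. ennreal (pmf \<pi> i) * (ennreal L * f i)) \<le> ennreal (pmf \<pi> j)"
  proof (rule suminf_le_of_tendsto)
    show "(\<lambda>n. ennreal (pmf \<pi> i) * ennreal (p i j (0 + real (Suc n)))) \<longlonglongrightarrow> ennreal (pmf \<pi> i) * (ennreal L * f i)" for i
      by (rule ennreal_tendsto_cmult[OF _ lim]) auto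
    show "(\<Sum>i. ennreal (pmf \<pi> i) * ennreal (p i j (0 + real (Suc n)))) \<le> ennreal (pmf \<pi> j)" for n
      by (subst stationary_suminf) auto
  qed (rule tendsto_const)
  then have "ennreal L \<le> ennreal (pmf \<pi> j)" by (simp add: f pmf_suminf)
  then have "L \<le> pmf \<pi> j" by simp
  then show "(p j j \<longlongrightarrow> pmf \<pi> j) at_top" using L by simp
qed

section \<open>Expected occupation times and their defects\<close>

text \<open>By \<open>nn_integral_sojourn_time\<close> this is the expected time in \<open>j\<close>
  until \<open>T\<close> from \<open>i\<close>.\<close>

definition occupation :: "nat \<Rightarrow> nat \<Rightarrow> real \<Rightarrow> ennreal" where
  "occupation i j T = (\<integral>\<^sup>+u. ennreal (p i j u) * indicator {0..T} u \<partial>lborel)"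

text \<open>\<open>delay_loss j T r\<close> is the expected time in \<open>j\<close> until \<open>T\<close> that a process started in \<open>j\<close> loses
  when its start is delayed by \<open>r\<close>.\<close>

definition delay_loss :: "nat \<Rightarrow> real \<Rightarrow> real \<Rightarrow> ennreal" where
  "delay_loss j T r = (\<integral>\<^sup>+v. (if T - r < v \<and> v \<le> T then diag j v else 0) \<partial>lborel)"

lemma borel_measurable_delay_loss [measurable]: "delay_loss j T \<in> borel_measurable borel"
  unfolding delay_loss_def by measurable

text \<open>For positive times \<open>first_passage\<close> writes \<open>p i j\<close> as an
  integral of a jointly measurable function; the value at 0 is set by hand.\<close>

lemma borel_measurable_transition [measurable]:
  "(\<lambda>u. ennreal (p i j u) * indicator {0..T} u) \<in> borel_measurable borel"
proof -
  interpret prob_space "P i" by (rule prob_space_P)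
  define g where "g = (\<lambda>u. if u = 0 then ennreal (p i j 0) else \<integral>\<^sup>+\<omega>. shifted_diag j (hitting_time X j \<omega>) u \<partial>P i)"
  have "g \<in> borel_measurable borel" unfolding g_def by measurable
  then have "(\<lambda>u. g u * indicator {0..T} u) \<in> borel_measurable borel" by measurable
  moreover have "(\<lambda>u. g u * indicator {0..T} u) = (\<lambda>u. ennreal (p i j u) * indicator {0..T} u)"
    by (auto simp: g_def fun_eq_iff indicator_def first_passage)
  ultimately show ?thesis by simp
qed

lemma occupation_diag: "occupation j j T = (\<integral>\<^sup>+v. (if v \<le> T then diag j v else 0) \<partial>lborel)"
  unfolding occupation_def by (intro nn_integral_cong) (auto simp: diag_def indicator_def)

lemma occupation_le: "0 \<le> T \<Longrightarrow> occupation i j T \<le> ennreal T"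
proof -
  assume T: "0 \<le> T"
  have "occupation i j T \<le> (\<integral>\<^sup>+u. indicator {0..T} u \<partial>lborel)"
    unfolding occupation_def by (intro nn_integral_mono) (auto simp: indicator_def)
  then show ?thesis using T by simp
qed

lemma occupation_row: "0 \<le> T \<Longrightarrow> (\<Sum>j. occupation i j T) = ennreal T"
proof -
  assume T: "0 \<le> T"
  have "(\<Sum>j. occupation i j T) = (\<integral>\<^sup>+u. (\<Sum>j. ennreal (p i j u) * indicator {0..T} u) \<partial>lborel)"
    unfolding occupation_def by (subst nn_integral_suminf) auto
  also have "\<dots> = (\<integral>\<^sup>+u. indicator {0..T} u \<partial>lborel)"
  proof (intro nn_integral_cong)
    fix u show "(\<Sum>j. ennreal (p i j u) * indicator {0..T} u) = indicator {0..T} u"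
      by (cases "u \<in> {0..T}") (simp_all add: p_row_ennreal del: suminf_ennreal)
  qed
  finally show ?thesis using T by simp
qed

lemma occupation_stationary: "0 \<le> T \<Longrightarrow> (\<Sum>i. ennreal (pmf \<pi> i) * occupation i j T) = ennreal (pmf \<pi> j) * ennreal T"
proof -
  assume T: "0 \<le> T"
  have "(\<Sum>i. ennreal (pmf \<pi> i) * occupation i j T) =
      (\<integral>\<^sup>+u. (\<Sum>i. ennreal (pmf \<pi> i) * (ennreal (p i j u) * indicator {0..T} u)) \<partial>lborel)"
    unfolding occupation_def by (subst nn_integral_suminf) (auto simp: nn_integral_cmult)
  also have "\<dots> = (\<integral>\<^sup>+u. ennreal (pmf \<pi> j) * indicator {0..T} u \<partial>lborel)"
  proof (intro nn_integral_cong)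
    fix u show "(\<Sum>i. ennreal (pmf \<pi> i) * (ennreal (p i j u) * indicator {0..T} u)) = ennreal (pmf \<pi> j) * indicator {0..T} u"
      by (cases "u \<in> {0..T}") (simp_all add: stationary_suminf)
  qed
  finally show ?thesis using T by (simp add: nn_integral_cmult_indicator)
qed

lemma nn_integral_lborel_shift:
  fixes f :: "real \<Rightarrow> ennreal"
  assumes "f \<in> borel_measurable borel"
  shows "(\<integral>\<^sup>+u. f u \<partial>lborel) = (\<integral>\<^sup>+u. f (r + u) \<partial>lborel)"
  using nn_integral_real_affine[OF assms, of 1 r] by simp

text \<open>Chapman-Kolmogorov at time \<open>s\<close>, integrated over the remaining time.\<close>

lemma occupation_add:
  assumes s: "0 \<le> s" and T: "0 \<le> T"
  shows "occupation i j (T + s) = occupation i j s + (\<Sum>k. ennreal (p i k s) * occupation k j T)"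
proof -
  have meas: "(\<lambda>v. ennreal (p i j v) * indicator {s..T + s} v) \<in> borel_measurable borel"
  proof -
    have "(\<lambda>v. (ennreal (p i j v) * indicator {0..T + s} v) * indicator {s..T + s} v) \<in> borel_measurable borel"
      by (intro borel_measurable_times_ennreal borel_measurable_transition) auto
    moreover have "(\<lambda>v. (ennreal (p i j v) * indicator {0..T + s} v) * indicator {s..T + s} v) =
        (\<lambda>v. ennreal (p i j v) * indicator {s..T + s} v)" using s by (auto simp: fun_eq_iff indicator_def)
    ultimately show ?thesis by simp
  qed
  have "(\<Sum>k. ennreal (p i k s) * occupation k j T) =
      (\<integral>\<^sup>+u. (\<Sum>k. ennreal (p i k s) * (ennreal (p k j u) * indicator {0..T} u)) \<partial>lborel)"
    unfolding occupation_def by (subst nn_integral_suminf) (auto simp: nn_integral_cmult)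
  also have "\<dots> = (\<integral>\<^sup>+u. ennreal (p i j (s + u)) * indicator {s..T + s} (s + u) \<partial>lborel)"
  proof (intro nn_integral_cong)
    fix u show "(\<Sum>k. ennreal (p i k s) * (ennreal (p k j u) * indicator {0..T} u)) =
        ennreal (p i j (s + u)) * indicator {s..T + s} (s + u)"
      using chapman_kolmogorov_ennreal[OF s, of u i j] by (cases "u \<in> {0..T}") (auto simp: indicator_def)
  qed
  also have "\<dots> = (\<integral>\<^sup>+v. ennreal (p i j v) * indicator {s..T + s} v \<partial>lborel)"
    by (rule nn_integral_lborel_shift[OF meas, symmetric])
  finally have "occupation i j s + (\<Sum>k. ennreal (p i k s) * occupation k j T) =
      (\<integral>\<^sup>+v. ennreal (p i j v) * indicator {0..s} v + ennreal (p i j v) * indicator {s..T + s} v \<partial>lborel)"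
    unfolding occupation_def using meas by (subst nn_integral_add) auto
  \<comment> \<open>The two time intervals share only the null set consisting of
    \<open>s\<close>.\<close>
  also have "\<dots> = occupation i j (T + s)"
    unfolding occupation_def
    by (rule nn_integral_cong_AE, use AE_lborel_singleton[of s] in eventually_elim)
      (use s T in \<open>auto simp: indicator_def\<close>)
  finally show ?thesis ..
qed

text \<open>On the added interval \<open>p j j\<close> is at least
  \<open>pmf \<pi> j\<close>.\<close>

lemma occupation_diag_add_le:
  assumes "0 \<le> s" "0 \<le> T"
  shows "occupation j j T + ennreal (pmf \<pi> j) * ennreal s \<le> occupation j j (T + s)"
proof -
  have "ennreal (pmf \<pi> j) * ennreal s = (\<integral>\<^sup>+v. ennreal (pmf \<pi> j) * indicator {T<..T + s} v \<partial>lborel)"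
    using assms by (subst nn_integral_cmult_indicator) auto
  then have "occupation j j T + ennreal (pmf \<pi> j) * ennreal s =
      (\<integral>\<^sup>+v. (if v \<le> T then diag j v else 0) + ennreal (pmf \<pi> j) * indicator {T<..T + s} v \<partial>lborel)"
    unfolding occupation_diag by (subst nn_integral_add) auto
  also have "\<dots> \<le> occupation j j (T + s)"
    unfolding occupation_diag
    by (intro nn_integral_mono) (use assms in \<open>auto simp: indicator_def diag_def intro!: ennreal_leI pmf_le_diag\<close>)
  finally show ?thesis .
qed

text \<open>\<open>first_passage\<close> integrated over time: from \<open>i\<close>, the time in
  \<open>j\<close> is that of a process started in \<open>j\<close> with delay equal to the hitting
  time. The loss stands on the right as a summand to avoid subtraction.\<close>

lemma occupation_decomposition:
  "occupation j j T = occupation i j T + (\<integral>\<^sup>+\<omega>. delay_loss j T (enn2real (hitting_time X j \<omega>)) \<partial>P i)"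
proof -
  interpret prob_space "P i" by (rule prob_space_P)
  interpret pair_sigma_finite lborel "P i" ..
  \<comment> \<open>Time in \<open>j\<close> until \<open>T\<close> after a delay \<open>r\<close>;
    \<open>W r\<close> and \<open>delay_loss j T r\<close> split the undelayed time at
    \<open>T - r\<close>.\<close>
  define W where "W = (\<lambda>r. \<integral>\<^sup>+v. (if v \<le> T - r then diag j v else 0) \<partial>lborel)"
  have [measurable]: "W \<in> borel_measurable borel" unfolding W_def by measurable
  have W_eq: "(\<integral>\<^sup>+u. diag j (u - r) * indicator {0..T} u \<partial>lborel) = W r" if "0 \<le> r" for r
  proof -
    have "(\<integral>\<^sup>+u. diag j (u - r) * indicator {0..T} u \<partial>lborel) = (\<integral>\<^sup>+u. diag j (r + u - r) * indicator {0..T} (r + u) \<partial>lborel)"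
      by (rule nn_integral_lborel_shift) measurable
    also have "\<dots> = W r"
      unfolding W_def using that by (intro nn_integral_cong) (auto simp: diag_def indicator_def)
    finally show ?thesis .
  qed
  have "occupation i j T = (\<integral>\<^sup>+u. (\<integral>\<^sup>+\<omega>. shifted_diag j (hitting_time X j \<omega>) u * indicator {0..T} u \<partial>P i) \<partial>lborel)"
    unfolding occupation_def
  proof (rule nn_integral_cong_AE, use AE_lborel_singleton[of "0::real"] in eventually_elim)
    case (elim u)
    then show ?case by (cases "u \<in> {0..T}") (auto simp: first_passage)
  qed
  also have "\<dots> = (\<integral>\<^sup>+\<omega>. (\<integral>\<^sup>+u. shifted_diag j (hitting_time X j \<omega>) u * indicator {0..T} u \<partial>lborel) \<partial>P i)"
    by (rule Fubini'[symmetric]) measurable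
  \<comment> \<open>Almost sure finiteness is essential here: \<open>enn2real\<close> maps an
    infinite hitting time to delay 0, whereas \<open>shifted_diag\<close> gives 0.\<close>
  also have "\<dots> = (\<integral>\<^sup>+\<omega>. W (enn2real (hitting_time X j \<omega>)) \<partial>P i)"
    by (rule nn_integral_cong_AE, use AE_hitting_time_finite[of j i] in eventually_elim)
      (simp add: shifted_diag_def W_eq)
  finally have "occupation i j T + (\<integral>\<^sup>+\<omega>. delay_loss j T (enn2real (hitting_time X j \<omega>)) \<partial>P i) =
      (\<integral>\<^sup>+\<omega>. W (enn2real (hitting_time X j \<omega>)) + delay_loss j T (enn2real (hitting_time X j \<omega>)) \<partial>P i)"
    by (subst nn_integral_add) auto
  also have "\<dots> = (\<integral>\<^sup>+\<omega>. occupation j j T \<partial>P i)"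
  proof (intro nn_integral_cong)
    fix \<omega>
    have "W r + delay_loss j T r = occupation j j T" if "0 \<le> r" for r
    proof -
      have "W r + delay_loss j T r = (\<integral>\<^sup>+v. (if v \<le> T - r then diag j v else 0) +
          (if T - r < v \<and> v \<le> T then diag j v else 0) \<partial>lborel)"
        unfolding W_def delay_loss_def by (rule nn_integral_add[symmetric]) measurable
      also have "\<dots> = occupation j j T"
        unfolding occupation_diag using that by (intro nn_integral_cong) auto
      finally show ?thesis .
    qed
    then show "W (enn2real (hitting_time X j \<omega>)) + delay_loss j T (enn2real (hitting_time X j \<omega>)) = occupation j j T"
      by simp
  qed
  also have "\<dots> = occupation j j T" by (simp add: emeasure_space_1)
  finally show ?thesis ..
qed

lemma delay_loss_le: "0 \<le> r \<Longrightarrow> delay_loss j T r \<le> ennreal r"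
proof -
  assume r: "0 \<le> r"
  have "delay_loss j T r \<le> (\<integral>\<^sup>+v. indicator {T - r<..T} v \<partial>lborel)"
    unfolding delay_loss_def by (intro nn_integral_mono) (auto simp: diag_le_1)
  then show ?thesis using r by simp
qed

text \<open>On the window of length \<open>r\<close> ending at \<open>x n\<close>, monotonicity
  squeezes \<open>p j j\<close> between \<open>pmf \<pi> j\<close> and its value at the left end,
  which tends to \<open>pmf \<pi> j\<close>.\<close>

lemma delay_loss_tendsto:
  assumes r: "0 \<le> r" and x: "filterlim x at_top sequentially"
  shows "(\<lambda>n. delay_loss j (x n) r) \<longlonglongrightarrow> ennreal (pmf \<pi> j) * ennreal r"
proof (rule tendsto_sandwich)
  have ev: "\<forall>\<^sub>F n in sequentially. r \<le> x n" using x by (auto simp: filterlim_at_top)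
  show "\<forall>\<^sub>F n in sequentially. ennreal (pmf \<pi> j) * ennreal r \<le> delay_loss j (x n) r"
    using ev
  proof eventually_elim
    case (elim n)
    have "ennreal (pmf \<pi> j) * ennreal r = (\<integral>\<^sup>+v. ennreal (pmf \<pi> j) * indicator {x n - r<..x n} v \<partial>lborel)"
      using r by (subst nn_integral_cmult_indicator) auto
    also have "\<dots> \<le> delay_loss j (x n) r"
      unfolding delay_loss_def
      by (intro nn_integral_mono) (use elim in \<open>auto simp: indicator_def diag_def intro!: ennreal_leI pmf_le_diag\<close>)
    finally show ?case .
  qed
  show "\<forall>\<^sub>F n in sequentially. delay_loss j (x n) r \<le> diag j (x n - r) * ennreal r"
    using ev
  proof eventually_elim
    case (elim n)
    have "delay_loss j (x n) r \<le> (\<integral>\<^sup>+v. diag j (x n - r) * indicator {x n - r<..x n} v \<partial>lborel)"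
      unfolding delay_loss_def
      by (intro nn_integral_mono) (use elim in \<open>auto simp: indicator_def diag_def intro!: ennreal_leI diag_antimono\<close>)
    also have "\<dots> = diag j (x n - r) * ennreal r"
      using r by (subst nn_integral_cmult_indicator) auto
    finally show ?case .
  qed
  have "filterlim (\<lambda>n. x n - r) at_top sequentially"
    using filterlim_tendsto_add_at_top[OF tendsto_const[of "-r"] x] by simp
  then have "(\<lambda>n. ennreal r * diag j (x n - r)) \<longlonglongrightarrow> ennreal r * ennreal (pmf \<pi> j)"
    by (intro ennreal_tendsto_cmult diag_seq_tendsto[OF diag_tendsto_pmf]) auto
  then show "(\<lambda>n. diag j (x n - r) * ennreal r) \<longlonglongrightarrow> ennreal (pmf \<pi> j) * ennreal r"
    by (simp add: mult.commute)
qed simp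

text \<open>If the limit is infinite, Fatou's lemma replaces dominated convergence.\<close>

lemma nn_integral_delay_loss_tendsto:
  assumes [measurable]: "\<theta> \<in> borel_measurable N" and fin: "AE \<omega> in N. \<theta> \<omega> \<noteq> \<top>"
    and x: "filterlim x at_top sequentially"
  shows "(\<lambda>n. \<integral>\<^sup>+\<omega>. delay_loss j (x n) (enn2real (\<theta> \<omega>)) \<partial>N) \<longlonglongrightarrow> ennreal (pmf \<pi> j) * (\<integral>\<^sup>+\<omega>. \<theta> \<omega> \<partial>N)"
proof -
  have lim: "AE \<omega> in N. (\<lambda>n. delay_loss j (x n) (enn2real (\<theta> \<omega>))) \<longlonglongrightarrow> ennreal (pmf \<pi> j) * \<theta> \<omega>"
    using fin
  proof eventually_elim
    case (elim \<omega>)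
    then show ?case
      using delay_loss_tendsto[OF enn2real_nonneg x, of j "\<theta> \<omega>"] by (simp add: less_top)
  qed
  show ?thesis
  proof (cases "(\<integral>\<^sup>+\<omega>. \<theta> \<omega> \<partial>N) = \<top>")
    case False
    have "(\<lambda>n. \<integral>\<^sup>+\<omega>. delay_loss j (x n) (enn2real (\<theta> \<omega>)) \<partial>N) \<longlonglongrightarrow> (\<integral>\<^sup>+\<omega>. ennreal (pmf \<pi> j) * \<theta> \<omega> \<partial>N)"
    proof (rule nn_integral_dominated_convergence[where w=\<theta>])
      show "AE \<omega> in N. delay_loss j (x n) (enn2real (\<theta> \<omega>)) \<le> \<theta> \<omega>" for n
        using fin
      proof eventually_elim
        case (elim \<omega>)
        then show ?case using delay_loss_le[of "enn2real (\<theta> \<omega>)" j "x n"] by (simp add: less_top)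
      qed
    qed (use False lim in \<open>auto simp: less_top\<close>)
    then show ?thesis by (simp add: nn_integral_cmult)
  next
    case True
    have "(\<integral>\<^sup>+\<omega>. ennreal (pmf \<pi> j) * \<theta> \<omega> \<partial>N) = (\<integral>\<^sup>+\<omega>. liminf (\<lambda>n. delay_loss j (x n) (enn2real (\<theta> \<omega>))) \<partial>N)"
      by (rule nn_integral_cong_AE, use lim in eventually_elim) (simp add: lim_imp_Liminf)
    also have "\<dots> \<le> liminf (\<lambda>n. \<integral>\<^sup>+\<omega>. delay_loss j (x n) (enn2real (\<theta> \<omega>)) \<partial>N)"
      by (rule nn_integral_liminf) measurable
    finally show ?thesis
      using True pmf_pos[of j] by (intro tendsto_if_le_liminf) (auto simp: nn_integral_cmult ennreal_mult_top)
  qed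
qed

section \<open>Mean hitting times and their weighted sums\<close>

definition mean_hitting :: "nat \<Rightarrow> nat \<Rightarrow> ennreal" where
  "mean_hitting i j = (\<integral>\<^sup>+\<omega>. hitting_time X j \<omega> \<partial>P i)"

text \<open>Prepared for summation over \<open>j\<close>: both \<open>pmf \<pi> j * s\<close> and
  \<open>occupation i j s\<close> then add up to \<open>s\<close> and cancel. It is the limit in
  \<open>T\<close> of a comparison of delay losses at \<open>T\<close> and
  \<open>T + s\<close>.\<close>

lemma mean_hitting_step:
  assumes s: "0 \<le> s"
  shows "ennreal (pmf \<pi> j) * ennreal s + (\<Sum>k. ennreal (p i k s) * (ennreal (pmf \<pi> j) * mean_hitting k j))
    \<le> occupation i j s + ennreal (pmf \<pi> j) * mean_hitting i j"
proof -
  define \<Gamma> where "\<Gamma> = (\<lambda>k T. \<integral>\<^sup>+\<omega>. delay_loss j T (enn2real (hitting_time X j \<omega>)) \<partial>P k)"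
  define c where "c = ennreal (pmf \<pi> j) * ennreal s"
  have dec: "occupation j j T = occupation k j T + \<Gamma> k T" for k T
    unfolding \<Gamma>_def by (rule occupation_decomposition)
  have \<Gamma>_lim: "(\<lambda>n. \<Gamma> k (x n)) \<longlonglongrightarrow> ennreal (pmf \<pi> j) * mean_hitting k j"
    if "filterlim x at_top sequentially" for k x
    unfolding \<Gamma>_def mean_hitting_def
    by (rule nn_integral_delay_loss_tendsto[OF _ AE_hitting_time_finite that]) measurable
  \<comment> \<open>The version before the limit, from the Markov property at \<open>s\<close> and
    the minimal growth of \<open>occupation j j\<close>.\<close>
  have ineq: "c + (\<Sum>k. ennreal (p i k s) * \<Gamma> k T) \<le> occupation i j s + \<Gamma> i (T + s)" if T: "0 \<le> T" for T
  proof -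
    define S where "S = (\<Sum>k. ennreal (p i k s) * \<Gamma> k T)"
    define U where "U = (\<Sum>k. ennreal (p i k s) * occupation k j T)"
    have "U + S = (\<Sum>k. ennreal (p i k s) * occupation k j T + ennreal (p i k s) * \<Gamma> k T)"
      unfolding U_def S_def by (rule suminf_add) auto
    also have "\<dots> = (\<Sum>k. ennreal (p i k s) * occupation j j T)"
      by (simp only: distrib_left[symmetric] dec[symmetric])
    finally have "U + S = (\<Sum>k. ennreal (p i k s) * occupation j j T)" .
    then have US: "U + S = occupation j j T" using p_row_ennreal[OF s, of i] by (simp del: suminf_ennreal)
    \<comment> \<open>Adding \<open>occupation j j T = U + S\<close> to both sides replaces
      subtraction; it is finite and can be cancelled.\<close>
    have "occupation j j T + (c + S) \<le> occupation j j (T + s) + S"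
      using occupation_diag_add_le[OF s T, of j] unfolding c_def add.assoc[symmetric] by (rule add_right_mono)
    also have "\<dots> = occupation i j s + U + \<Gamma> i (T + s) + S"
      by (subst dec[of "T + s" i], subst occupation_add[OF s T]) (simp only: U_def)
    also have "\<dots> = occupation j j T + (occupation i j s + \<Gamma> i (T + s))"
      unfolding US[symmetric] by (simp add: ac_simps)
    finally have le: "occupation j j T + (c + S) \<le> occupation j j T + (occupation i j s + \<Gamma> i (T + s))" .
    have "occupation j j T \<noteq> \<top>" using occupation_le[OF T, of j j] by (auto simp: top_unique)
    with le show ?thesis unfolding S_def ennreal_add_left_cancel_le by simp
  qed
  have seq: "filterlim (\<lambda>n. real n + s) at_top sequentially"
    using filterlim_tendsto_add_at_top[OF tendsto_const[of s] filterlim_real_sequentially] by (simp add: add.commute)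
  \<comment> \<open>The constant \<open>c\<close> is moved into the series, whose weights sum to 1,
    so that Fatou's lemma for series applies directly.\<close>
  have "(\<Sum>k. ennreal (p i k s) * (c + ennreal (pmf \<pi> j) * mean_hitting k j))
    \<le> occupation i j s + ennreal (pmf \<pi> j) * mean_hitting i j"
  proof (rule suminf_le_of_tendsto)
    show "(\<lambda>n. ennreal (p i k s) * (c + \<Gamma> k (real n))) \<longlonglongrightarrow> ennreal (p i k s) * (c + ennreal (pmf \<pi> j) * mean_hitting k j)" for k
      by (intro ennreal_tendsto_cmult tendsto_add tendsto_const \<Gamma>_lim filterlim_real_sequentially) auto
    show "(\<lambda>n. occupation i j s + \<Gamma> i (real n + s)) \<longlonglongrightarrow> occupation i j s + ennreal (pmf \<pi> j) * mean_hitting i j"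
      by (intro tendsto_add tendsto_const \<Gamma>_lim seq)
    fix n
    have "(\<Sum>k. ennreal (p i k s) * (c + \<Gamma> k (real n))) = (\<Sum>k. ennreal (p i k s) * c) + (\<Sum>k. ennreal (p i k s) * \<Gamma> k (real n))"
      by (subst suminf_add) (auto simp: distrib_left)
    also have "(\<Sum>k. ennreal (p i k s) * c) = c" using p_row_ennreal[OF s, of i] by (simp del: suminf_ennreal)
    finally show "(\<Sum>k. ennreal (p i k s) * (c + \<Gamma> k (real n))) \<le> occupation i j s + \<Gamma> i (real n + s)"
      using ineq[of "real n"] by simp
  qed
  moreover have "(\<Sum>k. ennreal (p i k s) * (c + ennreal (pmf \<pi> j) * mean_hitting k j)) =
      (\<Sum>k. ennreal (p i k s) * c) + (\<Sum>k. ennreal (p i k s) * (ennreal (pmf \<pi> j) * mean_hitting k j))"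
    by (subst suminf_add) (auto simp: distrib_left)
  moreover have "(\<Sum>k. ennreal (p i k s) * c) = c" using p_row_ennreal[OF s, of i] by (simp del: suminf_ennreal)
  ultimately show ?thesis by (simp only: c_def)
qed

text \<open>Summing \<open>mean_hitting_step\<close> over \<open>j\<close> and cancelling
  \<open>s\<close> shows that the sum is superharmonic in \<open>i\<close>; at \<open>i = 0\<close>
  it is \<open>kemeny\<close> by definition.\<close>

lemma kemeny_const: "(\<Sum>j. ennreal (pmf \<pi> j) * mean_hitting i j) = kemeny P X \<pi>"
proof -
  define K where "K = (\<lambda>i. \<Sum>j. ennreal (pmf \<pi> j) * mean_hitting i j)"
  have "K i = K 0"
  proof (rule superharmonic_const)
    fix s :: real and i assume s: "0 \<le> s"
    have "(\<Sum>j. ennreal (pmf \<pi> j) * ennreal s + (\<Sum>k. ennreal (p i k s) * (ennreal (pmf \<pi> j) * mean_hitting k j)))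
      \<le> (\<Sum>j. occupation i j s + ennreal (pmf \<pi> j) * mean_hitting i j)"
      by (rule suminf_mono_ennreal) (rule mean_hitting_step[OF s])
    also have "\<dots> = ennreal s + K i"
      by (subst suminf_add[symmetric]) (auto simp: occupation_row[OF s] K_def)
    also have "(\<Sum>j. ennreal (pmf \<pi> j) * ennreal s + (\<Sum>k. ennreal (p i k s) * (ennreal (pmf \<pi> j) * mean_hitting k j)))
      = (\<Sum>j. ennreal (pmf \<pi> j) * ennreal s) + (\<Sum>j. \<Sum>k. ennreal (p i k s) * (ennreal (pmf \<pi> j) * mean_hitting k j))"
      by (rule suminf_add[symmetric]) auto
    also have "(\<Sum>j. ennreal (pmf \<pi> j) * ennreal s) = ennreal s" using pmf_suminf by (simp del: suminf_ennreal)
    also have "(\<Sum>j. \<Sum>k. ennreal (p i k s) * (ennreal (pmf \<pi> j) * mean_hitting k j)) = (\<Sum>k. ennreal (p i k s) * K k)"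
      by (subst suminf_swap_ennreal) (simp add: K_def)
    finally show "(\<Sum>k. ennreal (p i k s) * K k) \<le> K i"
      unfolding ennreal_add_left_cancel_le by simp
  qed
  then show ?thesis by (simp add: K_def kemeny_def mean_hitting_def)
qed

text \<open>By \<open>occupation_diag_eq\<close> below, this is the integral of \<open>p j j u - pmf \<pi> j\<close> over \<open>{0..T}\<close>.\<close>

definition diag_excess :: "nat \<Rightarrow> real \<Rightarrow> ennreal" where
  "diag_excess j T = (\<Sum>i. ennreal (pmf \<pi> i) * (\<integral>\<^sup>+\<omega>. delay_loss j T (enn2real (hitting_time X j \<omega>)) \<partial>P i))"

text \<open>The \<pi>-average over \<open>i\<close> of \<open>occupation_decomposition\<close>; the
  occupation terms average to the linear part by stationarity.\<close>

lemma occupation_diag_eq: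
  assumes "0 \<le> T"
  shows "occupation j j T = ennreal (pmf \<pi> j) * ennreal T + diag_excess j T"
proof -
  have "occupation j j T = (\<Sum>i. ennreal (pmf \<pi> i) * occupation j j T)"
    using pmf_suminf by (simp del: suminf_ennreal)
  also have "\<dots> = (\<Sum>i. ennreal (pmf \<pi> i) * occupation i j T + 
      ennreal (pmf \<pi> i) * (\<integral>\<^sup>+\<omega>. delay_loss j T (enn2real (hitting_time X j \<omega>)) \<partial>P i))"
    unfolding distrib_left[symmetric] occupation_decomposition[symmetric] ..
  also have "\<dots> = ennreal (pmf \<pi> j) * ennreal T + diag_excess j T"
    by (subst suminf_add[symmetric]) (auto simp: occupation_stationary[OF assms] diag_excess_def)
  finally show ?thesis .
qed

text \<open>From \<open>S\<close> to \<open>T\<close> the diagonal occupation grows at least as fast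
  as the linear part.\<close>

lemma diag_excess_mono:
  assumes "0 \<le> S" "S \<le> T" shows "diag_excess j S \<le> diag_excess j T"
proof -
  have "ennreal T = ennreal S + ennreal (T - S)"
    using assms by (simp add: ennreal_plus[symmetric] del: ennreal_plus)
  then have "ennreal (pmf \<pi> j) * ennreal T + diag_excess j S = occupation j j S + ennreal (pmf \<pi> j) * ennreal (T - S)"
    unfolding occupation_diag_eq[OF assms(1)] by (simp add: distrib_left ac_simps)
  also have "\<dots> \<le> occupation j j T"
    using occupation_diag_add_le[of "T - S" S j] assms by simp
  also have "\<dots> = ennreal (pmf \<pi> j) * ennreal T + diag_excess j T"
    using assms by (simp add: occupation_diag_eq)
  finally show ?thesis
    unfolding ennreal_add_left_cancel_le by (simp add: ennreal_mult_eq_top_iff)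
qed

lemma diag_excess_tendsto:
  assumes x: "filterlim x at_top sequentially"
  shows "(\<lambda>n. diag_excess j (x n)) \<longlonglongrightarrow> ennreal (pmf \<pi> j) * (\<Sum>i. ennreal (pmf \<pi> i) * mean_hitting i j)"
proof -
  \<comment> \<open>The law of the process with initial distribution \<pi>. It turns the weighted
    series over \<open>i\<close> into one integral, so that
    \<open>nn_integral_delay_loss_tendsto\<close> applies to the whole series at once.\<close>
  define N where "N = measure_pmf \<pi> \<bind> P"
  have kernel: "P \<in> measure_pmf \<pi> \<rightarrow>\<^sub>M subprob_algebra M"
    by (auto simp: space_subprob_algebra sets_P prob_space_imp_subprob_space[OF prob_space_P])
  have sets_N: "sets N = sets M"
    unfolding N_def by (rule sets_bind) (auto simp: sets_P)
  have meas: "f \<in> borel_measurable M \<longleftrightarrow> f \<in> borel_measurable (P 0)" for f :: "'w \<Rightarrow> ennreal"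
    by (rule measurable_cong_sets[THEN arg_cong, of _ _ _ _ "\<lambda>A. f \<in> A"]) (simp_all add: sets_P)
  have \<theta>: "hitting_time X j \<in> borel_measurable M" unfolding meas by measurable
  have int_N: "(\<integral>\<^sup>+\<omega>. f \<omega> \<partial>N) = (\<Sum>i. ennreal (pmf \<pi> i) * (\<integral>\<^sup>+\<omega>. f \<omega> \<partial>P i))"
    if "f \<in> borel_measurable M" for f
    unfolding N_def
    by (simp add: nn_integral_bind[OF that kernel] nn_integral_measure_pmf nn_integral_count_space_nat)
  have "AE \<omega> in N. hitting_time X j \<omega> \<noteq> \<top>"
    unfolding N_def
    by (subst AE_bind[OF kernel]) (use \<theta> in \<open>auto simp: AE_hitting_time_finite\<close>)
  moreover have "hitting_time X j \<in> borel_measurable N"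
    using \<theta> measurable_cong_sets[OF sets_N refl] by blast
  ultimately have "(\<lambda>n. \<integral>\<^sup>+\<omega>. delay_loss j (x n) (enn2real (hitting_time X j \<omega>)) \<partial>N) \<longlonglongrightarrow>
      ennreal (pmf \<pi> j) * (\<integral>\<^sup>+\<omega>. hitting_time X j \<omega> \<partial>N)"
    by (intro nn_integral_delay_loss_tendsto x)
  moreover have "(\<lambda>\<omega>. delay_loss j T (enn2real (hitting_time X j \<omega>))) \<in> borel_measurable M" for T
    using \<theta> by measurable
  ultimately show ?thesis using \<theta> by (simp add: int_N diag_excess_def mean_hitting_def)
qed

text \<open>Each excess increases to its limit \<open>l j\<close>: monotonicity bounds the sum above
  by the sum of the limits, Fatou's lemma bounds it below. Exchanging the sums over \<open>i\<close>
  and \<open>j\<close> and using \<open>kemeny_const\<close> identifies the value.\<close>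

lemma suminf_diag_excess_tendsto: "((\<lambda>T. \<Sum>j. diag_excess j T) \<longlongrightarrow> kemeny P X \<pi>) at_top"
proof (rule tendsto_at_topI_sequentially)
  fix x :: "nat \<Rightarrow> real" assume x: "filterlim x at_top sequentially"
  define l where "l = (\<lambda>j. ennreal (pmf \<pi> j) * (\<Sum>i. ennreal (pmf \<pi> i) * mean_hitting i j))"
  have l_sum: "(\<Sum>j. l j) = kemeny P X \<pi>"
  proof -
    have "(\<Sum>j. l j) = (\<Sum>i. \<Sum>j. ennreal (pmf \<pi> j) * (ennreal (pmf \<pi> i) * mean_hitting i j))"
      unfolding l_def by (subst suminf_swap_ennreal) simp
    also have "\<dots> = (\<Sum>i. ennreal (pmf \<pi> i) * (\<Sum>j. ennreal (pmf \<pi> j) * mean_hitting i j))"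
      by (simp only: ennreal_suminf_cmult[symmetric] mult.left_commute)
    also have "\<dots> = kemeny P X \<pi>" unfolding kemeny_const using pmf_suminf by (simp del: suminf_ennreal)
    finally show ?thesis .
  qed
  have le: "diag_excess j T \<le> l j" if "0 \<le> T" for j T
  proof (rule tendsto_lowerbound)
    show "(\<lambda>n. diag_excess j (real n)) \<longlonglongrightarrow> l j"
      unfolding l_def by (rule diag_excess_tendsto[OF filterlim_real_sequentially])
    show "\<forall>\<^sub>F n in sequentially. diag_excess j T \<le> diag_excess j (real n)"
      using eventually_ge_at_top[of "nat \<lceil>T\<rceil>"]
      by eventually_elim (rule diag_excess_mono[OF that], linarith)
  qed simp
  \<comment> \<open>The upper bound \<open>le\<close> holds at nonnegative times only;
    \<open>y\<close> agrees with \<open>x\<close> eventually.\<close>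
  define y where "y = (\<lambda>n. max 0 (x n))"
  have y: "filterlim y at_top sequentially"
    by (rule filterlim_at_top_mono[OF x]) (simp add: y_def)
  have "(\<lambda>n. \<Sum>j. diag_excess j (y n)) \<longlonglongrightarrow> (\<Sum>j. l j)"
  proof (rule tendsto_if_le_liminf)
    show "(\<Sum>j. l j) \<le> liminf (\<lambda>n. \<Sum>j. diag_excess j (y n))"
      by (rule suminf_liminf_le) (unfold l_def, rule diag_excess_tendsto[OF y])
    show "(\<Sum>j. diag_excess j (y n)) \<le> (\<Sum>j. l j)" for n
      by (intro suminf_mono_ennreal le) (simp add: y_def)
  qed
  moreover have "\<forall>\<^sub>F n in sequentially. 0 \<le> x n" using x by (auto simp: filterlim_at_top)
  then have "\<forall>\<^sub>F n in sequentially. (\<Sum>j. diag_excess j (y n)) = (\<Sum>j. diag_excess j (x n))"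
    by eventually_elim (simp add: y_def)
  ultimately show "(\<lambda>n. \<Sum>j. diag_excess j (x n)) \<longlonglongrightarrow> kemeny P X \<pi>"
    unfolding l_sum by (rule Lim_transform_eventually)
qed

section \<open>Total expected sojourn time\<close>

lemma suminf_sojourn_time:
  assumes "0 \<le> t"
  shows "(\<Sum>j. \<integral>\<^sup>+\<omega>. sojourn_time X j t \<omega> \<partial>P j) = ennreal t + (\<Sum>j. diag_excess j t)"
proof -
  have "(\<Sum>j. \<integral>\<^sup>+\<omega>. sojourn_time X j t \<omega> \<partial>P j) = (\<Sum>j. ennreal (pmf \<pi> j) * ennreal t + diag_excess j t)"
    unfolding nn_integral_sojourn_time occupation_def[symmetric] occupation_diag_eq[OF assms] ..
  also have "\<dots> = (\<Sum>j. ennreal (pmf \<pi> j) * ennreal t) + (\<Sum>j. diag_excess j t)"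
    by (rule suminf_add[symmetric]) auto
  also have "(\<Sum>j. ennreal (pmf \<pi> j) * ennreal t) = ennreal t" using pmf_suminf by (simp del: suminf_ennreal)
  finally show ?thesis .
qed

end

theorem corollary5p4:
  fixes M :: "'w measure" and P :: "nat \<Rightarrow> 'w measure" and X :: "real \<Rightarrow> 'w \<Rightarrow> nat"
    and lam mu :: "nat \<Rightarrow> real" and \<pi> :: "nat pmf"
  assumes "birth_death_process M P X lam mu"
    and "irreducible_process P X"
    and "positive_recurrent P X"
    and "stationary_distribution P X \<pi>"
    and "Theta lam \<pi> < \<infinity>"
  shows "((\<lambda>t. enn2ereal (\<Sum>j. \<integral>\<^sup>+\<omega>. sojourn_time X j t \<omega> \<partial>P j) - ereal t)
           \<longlongrightarrow> enn2ereal (kemeny P X \<pi>)) at_top"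
proof -
  interpret stationary_birth_death_process M P X lam mu \<pi>
    using assms by (simp add: stationary_birth_death_process_def stationary_birth_death_process_axioms_def)
  have "((\<lambda>t. enn2ereal (\<Sum>j. diag_excess j t)) \<longlongrightarrow> enn2ereal (kemeny P X \<pi>)) at_top"
    by (rule tendsto_enn2erealI[OF suminf_diag_excess_tendsto])
  moreover have "\<forall>\<^sub>F t in at_top. enn2ereal (\<Sum>j. diag_excess j t) =
      enn2ereal (\<Sum>j. \<integral>\<^sup>+\<omega>. sojourn_time X j t \<omega> \<partial>P j) - ereal t"
    using eventually_ge_at_top[of 0]
  proof eventually_elim
    case (elim t)
    \<comment> \<open>Only the finite \<open>t\<close> is cancelled, so the identity holds for
      infinite \<open>e\<close> as well.\<close>
    have "ereal t + e - ereal t = e" for e by (cases e) auto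
    then show ?case using elim by (simp add: suminf_sojourn_time plus_ennreal.rep_eq)
  qed
  ultimately show ?thesis by (rule Lim_transform_eventually)
qed

end
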